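(* (Karlin–McGregor formula for a QMC on $\mathbb{Z}$.) Let $\Phi$ be a block tridiagonal quantum Markov chain on $\mathbb{Z}$ with internal space $\mathbb{C}^N$, with blocks $A_k,B_k,C_k\in M_{N^2}(\mathbb{C})$, $k\in\mathbb{Z}$, in positions $(k+1,k)$, $(k,k)$, $(k-1,k)$ respectively, and all other blocks zero. Assume that $A_n$ ($n\ge 0$) and $C_n$ ($n\le -1$) are nonsingular, and that there exist Hermitian matrices $(E_n)_{n\in\mathbb{Z}}$ and nonsingular matrices $(R_n)_{n\in\mathbb{Z}}$ in $M_{N^2}(\mathbb{C})$ such that $$A_n^*R_{n+1}^*R_{n+1}=R_n^*R_nC_{n+1},\qquad R_{-n-1}^*R_{-n-1}C_{-n}=A_{-n-1}^*R_{-n}^*R_{-n}\qquad (n\ge 0),$$ and $R_nB_n=E_nR_n$ for all $n\in\mathbb{Z}$. Put $\Pi_j=R_j^*R_j$. Then there exists a $2N^2\times 2N^2$ weight matrix $$W=\begin{bmatrix}W_{11}&W_{12}\\ W_{21}&W_{22}\end{bmatrix},\qquad W_{21}=W_{12}^*,$$ with $N^2\times N^2$ blocks, such that for all $i,j\in\mathbb{Z}$ and $n\ge 0$, $$\Phi^{(n)}_{ji}=\sum_{\alpha,\beta=1}^{2}\Pi_j^{-1}\int_{\mathbb{R}}x^n\,Q_j^{\alpha}(x)^*\,dW_{\alpha\beta}(x)\,Q_i^{\beta}(x).$$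
   Context: A quantum Markov chain (QMC) on a vertex set $V$ with internal space $\mathbb{C}^N$ is a block matrix $\Phi=(\Phi_{ij})_{i,j\in V}$ of completely positive maps $\Phi_{ij}$ on $M_N(\mathbb{C})$ such that each column sum $\sum_{i\in V}\Phi_{ij}$ is trace-preserving; each $\Phi_{ij}$ is identified with the $N^2\times N^2$ matrix $M$ satisfying $\mathrm{vec}(\Phi_{ij}(X))=M\,\mathrm{vec}(X)$, where $\mathrm{vec}$ stacks the rows of a matrix. $\Phi^{(n)}_{ji}$ denotes the $(j,i)$ block of $\Phi^n$. The two families of matrix-valued polynomials $(Q^\alpha_n)_{n\in\mathbb{Z}}$, $\alpha=1,2$, are defined by $Q_0^1=I_{N^2}$, $Q_0^2=0$, $Q_{-1}^1=0$, $Q_{-1}^2=I_{N^2}$ and $$xQ_n^\alpha(x)=Q_{n+1}^\alpha(x)A_n+Q_n^\alpha(x)B_n+Q_{n-1}^\alpha(x)C_n,\qquad n\in\mathbb{Z}.$$ A weight matrix is a matrix of measures on $\mathbb{R}$ with finite moments which is positive semidefinite (its value on every Borel set is a positive semidefinite matrix). For real $x$, $Q(x)^*$ is the conjugate transpose. *)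

theory Defs
  imports "HOL-Analysis.Analysis"
begin

definition cadj :: "complex ^ 'n ^ 'm \<Rightarrow> complex ^ 'm ^ 'n"
  where "cadj M = (\<chi> i j. cnj (M $ j $ i))"

definition hermitian :: "complex ^ 'n ^ 'n \<Rightarrow> bool"
  where "hermitian M \<longleftrightarrow> cadj M = M"

definition psd :: "complex ^ 'n ^ 'n \<Rightarrow> bool"
  where "psd M \<longleftrightarrow> hermitian M \<and>
    (\<forall>v. (\<Sum>i\<in>UNIV. \<Sum>j\<in>UNIV. cnj (v $ i) * M $ i $ j * v $ j) \<in> \<real>\<^sub>\<ge>\<^sub>0)"


subsection \<open>Quantum Markov chains\<close>

(* A k-by-k block matrix over M_n(C), given by its blocks X i j for i, j < k, that is positive
   semidefinite as a matrix on C^k (x) C^n. *)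
definition block_psd :: "nat \<Rightarrow> (nat \<Rightarrow> nat \<Rightarrow> complex ^ 'n ^ 'n) \<Rightarrow> bool"
  where "block_psd k X \<longleftrightarrow>
    (\<forall>i<k. \<forall>j<k. cadj (X i j) = X j i) \<and>
    (\<forall>v :: nat \<Rightarrow> complex ^ 'n.
      (\<Sum>i<k. \<Sum>j<k. \<Sum>p\<in>UNIV. \<Sum>q\<in>UNIV. cnj (v i $ p) * X i j $ p $ q * v j $ q) \<in> \<real>\<^sub>\<ge>\<^sub>0)"

(* Complex linearity together with positivity of id_k (x) F for every k. *)
definition completely_positive :: "(complex ^ 'n ^ 'n \<Rightarrow> complex ^ 'n ^ 'n) \<Rightarrow> bool"
  where "completely_positive F \<longleftrightarrow>
    (\<forall>X Y. F (X + Y) = F X + F Y) \<and>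
    (\<forall>c X. F (\<chi> p q. c * X $ p $ q) = (\<chi> p q. c * F X $ p $ q)) \<and>
    (\<forall>k X. block_psd k X \<longrightarrow> block_psd k (\<lambda>i j. F (X i j)))"

definition trace_preserving :: "(complex ^ 'n ^ 'n \<Rightarrow> complex ^ 'n ^ 'n) \<Rightarrow> bool"
  where "trace_preserving F \<longleftrightarrow> (\<forall>X. trace (F X) = trace X)"

(* Row stacking: the coordinate with index (p, q) of vec(X) is the entry of X in row p, column q,
   so that N^2-dimensional space is indexed by pairs. *)
definition vec_rows :: "complex ^ 'n ^ 'n \<Rightarrow> complex ^ ('n \<times> 'n)"
  where "vec_rows X = (\<chi> r. X $ fst r $ snd r)"

definition unvec_rows :: "complex ^ ('n \<times> 'n) \<Rightarrow> complex ^ 'n ^ 'n"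
  where "unvec_rows v = (\<chi> p q. v $ (p, q))"

lemma unvec_vec_rows [simp]: "unvec_rows (vec_rows X) = X"
  by (simp add: unvec_rows_def vec_rows_def vec_eq_iff)

lemma vec_unvec_rows [simp]: "vec_rows (unvec_rows v) = v"
  by (simp add: unvec_rows_def vec_rows_def vec_eq_iff)

(* The map F on M_n(C) that is identified with M, i.e. vec(F(X)) = M vec(X). *)
definition superop ::
  "complex ^ ('n \<times> 'n) ^ ('n \<times> 'n) \<Rightarrow> complex ^ 'n ^ 'n \<Rightarrow> complex ^ 'n ^ 'n"
  where "superop M X = unvec_rows (M *v vec_rows X)"

definition quantum_Markov_chain ::
  "('v \<Rightarrow> 'v \<Rightarrow> complex ^ ('n::finite \<times> 'n) ^ ('n \<times> 'n)) \<Rightarrow> bool"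
  where "quantum_Markov_chain \<Phi> \<longleftrightarrow>
    (\<forall>i j. completely_positive (superop (\<Phi> i j))) \<and>
    (\<forall>j. (\<lambda>i. \<Phi> i j) summable_on UNIV \<and>
         trace_preserving (superop (\<Sum>\<^sub>\<infinity>i. \<Phi> i j)))"

(* block_power \<Phi> n j i is the (j, i) block of the n-th power of the block matrix \<Phi>. *)
fun block_power ::
  "('v \<Rightarrow> 'v \<Rightarrow> complex ^ 'm ^ 'm) \<Rightarrow> nat \<Rightarrow> 'v \<Rightarrow> 'v \<Rightarrow> complex ^ 'm ^ 'm"
  where
    "block_power \<Phi> 0 j i = (if j = i then mat 1 else 0)"
  | "block_power \<Phi> (Suc n) j i = (\<Sum>\<^sub>\<infinity>k. \<Phi> j k ** block_power \<Phi> n k i)"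

definition block_tridiagonal ::
  "(int \<Rightarrow> int \<Rightarrow> complex ^ 'm ^ 'm) \<Rightarrow> (int \<Rightarrow> complex ^ 'm ^ 'm) \<Rightarrow>
   (int \<Rightarrow> complex ^ 'm ^ 'm) \<Rightarrow> (int \<Rightarrow> complex ^ 'm ^ 'm) \<Rightarrow> bool"
  where "block_tridiagonal \<Phi> A B C \<longleftrightarrow>
    (\<forall>k. \<Phi> (k + 1) k = A k) \<and> (\<forall>k. \<Phi> k k = B k) \<and> (\<forall>k. \<Phi> (k - 1) k = C k) \<and>
    (\<forall>i j. \<bar>i - j\<bar> > 1 \<longrightarrow> \<Phi> i j = 0)"


subsection \<open>Matrix-valued polynomials\<close>

definition eval_pmat :: "complex poly ^ 'n ^ 'm \<Rightarrow> real \<Rightarrow> complex ^ 'n ^ 'm"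
  where "eval_pmat P x = (\<chi> i j. poly (P $ i $ j) (of_real x))"

(* The superscript ranges over the two-element type 2, whose elements are 1 and 2
   (the latter coincides with 0 there). *)
definition KM_polynomials ::
  "(int \<Rightarrow> complex ^ 'm ^ 'm) \<Rightarrow> (int \<Rightarrow> complex ^ 'm ^ 'm) \<Rightarrow> (int \<Rightarrow> complex ^ 'm ^ 'm) \<Rightarrow>
   (2 \<Rightarrow> int \<Rightarrow> complex poly ^ 'm ^ 'm) \<Rightarrow> bool"
  where "KM_polynomials A B C Q \<longleftrightarrow>
    Q 1 0 = mat 1 \<and> Q 2 0 = 0 \<and> Q 1 (-1) = 0 \<and> Q 2 (-1) = mat 1 \<and>
    (\<forall>\<alpha> n x. x *\<^sub>R eval_pmat (Q \<alpha> n) x =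
       eval_pmat (Q \<alpha> (n + 1)) x ** A n + eval_pmat (Q \<alpha> n) x ** B n
       + eval_pmat (Q \<alpha> (n - 1)) x ** C n)"


subsection \<open>Complex measures and weight matrices\<close>

(* Complex measures on the Borel sets of the real line, as set functions; the values on
   non-Borel sets are irrelevant. *)
definition complex_measure :: "(real set \<Rightarrow> complex) \<Rightarrow> bool"
  where "complex_measure \<mu> \<longleftrightarrow>
    (\<forall>F :: nat \<Rightarrow> real set. range F \<subseteq> sets borel \<longrightarrow> disjoint_family F \<longrightarrow>
       (\<lambda>n. \<mu> (F n)) sums \<mu> (\<Union>n. F n))"

(* The positive part of the Jordan decomposition of a finite signed measure; ennreal sends
   negative values to 0, which does not affect the supremum since F = {} is admitted. *)
definition pos_part :: "(real set \<Rightarrow> real) \<Rightarrow> real measure"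
  where "pos_part \<nu> = measure_of UNIV (sets borel)
    (\<lambda>E. SUP F\<in>{F \<in> sets borel. F \<subseteq> E}. ennreal (\<nu> F))"

definition neg_part :: "(real set \<Rightarrow> real) \<Rightarrow> real measure"
  where "neg_part \<nu> = pos_part (\<lambda>E. - \<nu> E)"

definition signed_integral :: "(real set \<Rightarrow> real) \<Rightarrow> (real \<Rightarrow> complex) \<Rightarrow> complex"
  where "signed_integral \<nu> f = (LINT x|pos_part \<nu>. f x) - (LINT x|neg_part \<nu>. f x)"

definition cm_integral :: "(real set \<Rightarrow> complex) \<Rightarrow> (real \<Rightarrow> complex) \<Rightarrow> complex"
  where "cm_integral \<mu> f =
    signed_integral (\<lambda>E. Re (\<mu> E)) f + \<i> * signed_integral (\<lambda>E. Im (\<mu> E)) f"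

definition finite_moments :: "(real set \<Rightarrow> complex) \<Rightarrow> bool"
  where "finite_moments \<mu> \<longleftrightarrow>
    (\<forall>n :: nat. \<forall>\<nu> \<in> {\<lambda>E. Re (\<mu> E), \<lambda>E. Im (\<mu> E)}.
       integrable (pos_part \<nu>) (\<lambda>x. x ^ n) \<and> integrable (neg_part \<nu>) (\<lambda>x. x ^ n))"

definition weight_matrix :: "(real set \<Rightarrow> complex ^ 'd ^ 'd) \<Rightarrow> bool"
  where "weight_matrix W \<longleftrightarrow>
    (\<forall>a b. complex_measure (\<lambda>S. W S $ a $ b) \<and> finite_moments (\<lambda>S. W S $ a $ b)) \<and>
    (\<forall>S \<in> sets borel. psd (W S))"

(* The integral of F(x) dW(x) G(x). *)
definition matrix_integral ::
  "(real \<Rightarrow> complex ^ 'a ^ 'p) \<Rightarrow> (real set \<Rightarrow> complex ^ 'b ^ 'a) \<Rightarrow>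
   (real \<Rightarrow> complex ^ 'q ^ 'b) \<Rightarrow> complex ^ 'q ^ 'p"
  where "matrix_integral F W G = (\<chi> p q. \<Sum>a\<in>UNIV. \<Sum>b\<in>UNIV.
    cm_integral (\<lambda>S. W S $ a $ b) (\<lambda>x. F x $ p $ a * G x $ b $ q))"

(* The blocks of a two-by-two block matrix. *)
definition block :: "(real set \<Rightarrow> complex ^ (2 \<times> 'm::finite) ^ (2 \<times> 'm)) \<Rightarrow> 2 \<Rightarrow> 2 \<Rightarrow>
   real set \<Rightarrow> complex ^ 'm ^ 'm"
  where "block W \<alpha> \<beta> S = (\<chi> a b. W S $ (\<alpha>, a) $ (\<beta>, b))"

end

theory Submission
  imports Defs "HOL-Probability.Probability"
begin

text \<open>The condition on \<open>R\<close> says that the chain is symmetric for the inner product with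
  weights \<open>\<Pi>\<^sub>j = R\<^sub>j\<^sup>* R\<^sub>j\<close>. Hence the \<open>2N\<^sup>2 \<times> 2N\<^sup>2\<close> matrices with blocks \<open>\<Pi>\<^sub>j \<Phi>\<^sup>(\<^sup>n\<^sup>)\<^sub>j\<^sub>i\<close>, \<open>i, j \<in> {0, -1}\<close>,
  have positive semidefinite Hankel forms. Complete positivity and preservation of the trace
  bound the entries of \<open>\<Phi>\<^sup>(\<^sup>n\<^sup>)\<^sub>j\<^sub>i\<close> uniformly in \<open>n\<close>, so these matrices are the moments of a matrix of
  measures on \<open>[-1, 1]\<close>. For each vector this is a scalar moment problem, solved as a
  weak limit of Bernstein-type discrete measures; polarization assembles the scalar measures
  into a density with respect to a common measure, and Weierstrass approximation shows that the
  density is positive semidefinite. Finally \<open>\<Pi>\<^sub>j \<Phi>\<^sup>(\<^sup>n\<^sup>)\<^sub>j\<^sub>i\<close> and the integrals satisfy the same three-term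
  recurrences in \<open>i\<close> and in \<open>j\<close>, and agree for \<open>i, j \<in> {0, -1}\<close>.\<close>

subsection \<open>The moment problem for bounded moment sequences\<close>


text \<open>No spectral theorem for the symmetrized operator is invoked. Positive Hankel forms and
  bounded moments give, by Cauchy-Schwarz, that \<open>L (x^n q^2)\<close> is at most
  \<open>L (q^2)\<close> in modulus, and this confines every measure to [-1, 1]. There continuous
  functions are bounded and polynomials are dense, so the moments decide the sign of a density. The
  obstacle is that compactness produces a measure for each vector separately, and nothing makes
  these measures depend quadratically on the vector. So only finitely many vectors contribute to the
  entries of the weight, and positivity for all the others has to be recovered from the moments of
  the entries. Integrals against an entry are defined through Jordan parts, which do not add up when
  measures are added. Densities with respect to one positive measure turn them into ordinary
  integrals. The sites 0 and -1 are distinguished because the pair of polynomials is (I, 0) and (0,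
  I) there, so that the formula at these sites is a statement about moments; they are also the two
  adjacent initial columns that a three-term recurrence on the integers requires.\<close>

definition moment_functional :: "(nat \<Rightarrow> 'a::comm_ring_1) \<Rightarrow> 'a poly \<Rightarrow> 'a"
  where "moment_functional m p = (\<Sum>k\<le>degree p. coeff p k * m k)"

lemma moment_functional_eq:
  assumes "degree p \<le> N"
  shows "moment_functional m p = (\<Sum>k\<le>N. coeff p k * m k)"
  unfolding moment_functional_def using assms
  by (intro sum.mono_neutral_left) (auto simp: coeff_eq_0)

lemma moment_functional_add:
  "moment_functional m (p + q) = moment_functional m p + moment_functional m q"
proof -
  let ?N = "max (degree p) (degree q)"
  have "degree (p + q) \<le> ?N" by (rule degree_add_le_max)
  then show ?thesis
    by (simp add: moment_functional_eq[of _ ?N] sum.distrib ring_distribs)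
qed

lemma moment_functional_smult:
  "moment_functional m (smult c p) = c * moment_functional m p"
  by (subst moment_functional_eq[of _ "degree p"])
     (auto simp: degree_smult_le moment_functional_def sum_distrib_left mult.assoc)

lemma moment_functional_minus: "moment_functional m (- p) = - moment_functional m p"
  using moment_functional_smult[of m "-1" p] by simp

lemma moment_functional_diff:
  "moment_functional m (p - q) = moment_functional m p - moment_functional m q"
  using moment_functional_add[of m p "- q"] by (simp add: moment_functional_minus)

lemma moment_functional_0 [simp]: "moment_functional m 0 = 0"
  by (simp add: moment_functional_def)

lemma moment_functional_sum:
  "moment_functional m (\<Sum>i\<in>S. f i) = (\<Sum>i\<in>S. moment_functional m (f i))"
  by (induction S rule: infinite_finite_induct) (auto simp: moment_functional_add)

lemma moment_functional_monom: "moment_functional m (monom c k) = c * m k"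
  by (subst moment_functional_eq[of _ k])
     (auto simp: degree_monom_le if_distrib[of "\<lambda>x. x * _"] cong: if_cong)

text \<open>With \<open>p = q\<close> the Riesz functional at a square becomes the Hankel form of
  \<open>m\<close> at the coefficients of \<open>p\<close>; factorizations of the moments enter
  through this form.\<close>

lemma moment_functional_mult:
  "moment_functional m (p * q) =
     (\<Sum>i\<le>degree p. \<Sum>j\<le>degree q. coeff p i * coeff q j * m (i + j))"
proof -
  have "p * q = (\<Sum>i\<le>degree p. monom (coeff p i) i) * (\<Sum>j\<le>degree q. monom (coeff q j) j)"
    by (simp only: poly_as_sum_of_monoms)
  also have "\<dots> = (\<Sum>i\<le>degree p. \<Sum>j\<le>degree q. monom (coeff p i * coeff q j) (i + j))"
    by (simp add: sum_product mult_monom)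
  finally show ?thesis
    by (simp add: moment_functional_sum moment_functional_monom)
qed

lemma moment_functional_integral:
  fixes h :: "real \<Rightarrow> real"
  assumes "\<And>k. integrable M (\<lambda>x. x ^ k * h x)" and "\<And>k. (\<integral>x. x ^ k * h x \<partial>M) = m k"
  shows "(\<integral>x. poly p x * h x \<partial>M) = moment_functional m p"
proof -
  have "poly p x * h x = (\<Sum>k\<le>degree p. coeff p k * (x ^ k * h x))" for x
    by (simp add: poly_altdef sum_distrib_right mult.assoc)
  then show ?thesis
    using assms by (simp add: moment_functional_def)
qed

section \<open>Binomial sums and the factorial moments of Bernstein weights\<close>

lemma sum_binomial_choose:
  fixes y z :: "'a::comm_semiring_1"
  assumes "i \<le> n"
  shows "(\<Sum>k\<le>n. of_nat ((n choose k) * (k choose i)) * (y ^ k * z ^ (n - k)))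
    = of_nat (n choose i) * (y ^ i * (y + z) ^ (n - i))"
proof -
  have "(\<Sum>k\<le>n. of_nat ((n choose k) * (k choose i)) * (y ^ k * z ^ (n - k)))
    = (\<Sum>j\<le>n - i. of_nat ((n choose (i + j)) * ((i + j) choose i)) * (y ^ (i + j) * z ^ (n - (i + j))))"
  proof -
    have "(\<Sum>k\<le>n. of_nat ((n choose k) * (k choose i)) * (y ^ k * z ^ (n - k)))
      = (\<Sum>k\<in>{i..n}. of_nat ((n choose k) * (k choose i)) * (y ^ k * z ^ (n - k)))"
      by (intro sum.mono_neutral_right) (auto simp: binomial_eq_0)
    also have "\<dots> = (\<Sum>j\<le>n - i. of_nat ((n choose (i + j)) * ((i + j) choose i)) * (y ^ (i + j) * z ^ (n - (i + j))))"
      using assms by (intro sum.reindex_bij_witness[of _ "\<lambda>j. i + j" "\<lambda>k. k - i"]) auto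
    finally show ?thesis .
  qed
  \<comment> \<open>Trinomial revision, \<open>(n choose k) (k choose i) = (n choose i) ((n - i)
    choose (k - i))\<close>, leaves the expansion of \<open>(y + z) ^ (n - i)\<close>. The semiring
    is general because \<open>y\<close> and \<open>z\<close> will be polynomials with sum 1.\<close>
  also have "\<dots> = (\<Sum>j\<le>n - i. of_nat (n choose i) * (y ^ i * (of_nat ((n - i) choose j) * y ^ j * z ^ (n - i - j))))"
    using assms by (intro sum.cong refl) (simp add: choose_mult power_add mult_ac)
  also have "\<dots> = of_nat (n choose i) * (y ^ i * (y + z) ^ (n - i))"
    by (simp add: binomial_ring sum_distrib_left)
  finally show ?thesis .
qed

text \<open>Both terms are products of \<open>i\<close> factors of modulus at most 1, so they differ
  by at most the sum of the differences of the factors. For \<open>k < j\<close> the factor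
  \<open>(k - j) / (n - j)\<close> is negative, and \<open>n \<ge> 2 * i + 1\<close> keeps its
  modulus at most 1. The bound is uniform in \<open>k\<close>.\<close>

lemma choose_quotient_approx:
  assumes "n \<ge> 2 * i + 1" and "k \<le> n"
  shows "\<bar>real (k choose i) / real (n choose i) - (real k / real n) ^ i\<bar> \<le> real i * (real i / real (n - i))"
proof -
  have "real (k choose i) / real (n choose i) = (\<Prod>j<i. (real k - real j) / (real n - real j))"
    by (simp add: binomial_gbinomial gbinomial_prod_rev prod_dividef atLeast0LessThan)
  then have "\<bar>real (k choose i) / real (n choose i) - (real k / real n) ^ i\<bar>
      = norm ((\<Prod>j<i. (real k - real j) / (real n - real j)) - (\<Prod>j<i. real k / real n))"
    by simp
  also have "\<dots> \<le> (\<Sum>j<i. norm ((real k - real j) / (real n - real j) - real k / real n))"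
    using assms by (intro norm_prod_diff) (auto simp: divide_simps)
  also have "\<dots> \<le> (\<Sum>j<i. real i / real (n - i))"
  proof (intro sum_mono)
    fix j assume "j \<in> {..<i}"
    then have j: "j < i" by simp
    have "(real k - real j) / (real n - real j) - real k / real n
        = - (real j * ((real n - real k) / real n)) / (real n - real j)"
      using j assms by (simp add: divide_simps) (simp add: algebra_simps)
    also have "norm \<dots> = real j * ((real n - real k) / real n) / (real n - real j)"
      using j assms by (simp add: abs_mult)
    also have "\<dots> \<le> real i / real (n - i)"
    proof (rule frac_le)
      have "(real n - real k) / real n \<le> 1"
        using assms by simp
      then show "real j * ((real n - real k) / real n) \<le> real i"
        using j assms mult_mono[of "real j" "real i" "(real n - real k) / real n" 1] by simp
    qed (use j assms in auto)
    finally show "norm ((real k - real j) / (real n - real j) - real k / real n) \<le> real i / real (n - i)" .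
  qed
  finally show ?thesis by simp
qed

text \<open>Uniform boundedness is what forces the support into [-1, 1]: mass outside that interval
  would make the even moments unbounded.\<close>

locale bounded_moments =
  fixes m :: "nat \<Rightarrow> real" and K :: real
  assumes square_nonneg: "moment_functional m (p * p) \<ge> 0"
    and moment_bound: "\<bar>m k\<bar> \<le> K"
begin

abbreviation "L \<equiv> moment_functional m"

text \<open>The binary form \<open>L ((s p + t q)^2)\<close> is nonnegative; at
  \<open>s = b\<close>, \<open>t = - a\<close> it equals \<open>a (a c - b^2)\<close>. If
  \<open>a = 0\<close> and \<open>b \<noteq> 0\<close>, a suitable \<open>s\<close> with
  \<open>t = 1\<close> would give it the value \<open>-1\<close>.\<close>

lemma Cauchy_Schwarz: "(L (p * q))\<^sup>2 \<le> L (p * p) * L (q * q)"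
proof -
  define a b c where "a = L (p * p)" and "b = L (p * q)" and "c = L (q * q)"
  have form: "s\<^sup>2 * a + 2 * s * t * b + t\<^sup>2 * c \<ge> 0" for s t
  proof -
    have "(smult s p + smult t q) * (smult s p + smult t q)
      = smult (s\<^sup>2) (p * p) + smult (2 * s * t) (p * q) + smult (t\<^sup>2) (q * q)"
      by (simp add: mult.commute[of q p] smult_add_right power2_eq_square ring_distribs mult.assoc flip: smult_add_left)
    then show ?thesis
      using square_nonneg[of "smult s p + smult t q"]
      by (simp add: moment_functional_add moment_functional_smult a_def b_def c_def)
  qed
  have a0: "a \<ge> 0" by (simp add: a_def square_nonneg)
  show ?thesis
  proof (cases "a = 0")
    case True
    have "b = 0"
    proof (rule ccontr)
      assume "b \<noteq> 0"
      then show False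
        using form[of "- (c + 1) / (2 * b)" 1] True by (simp add: field_simps)
    qed
    then show ?thesis by (simp flip: a_def b_def c_def add: True)
  next
    case False
    have "0 \<le> a * (a * c - b\<^sup>2)"
      using form[of b "- a"] by (simp add: algebra_simps power2_eq_square)
    then show ?thesis
      using a0 False by (simp flip: a_def b_def c_def add: zero_le_mult_iff)
  qed
qed

text \<open>Iterating Cauchy--Schwarz gives \<open>\<bar>L (x\<^sup>n q\<^sup>2)\<bar> ^ 2\<^sup>j \<le> L (x ^ (n 2\<^sup>j) q\<^sup>2) L (q\<^sup>2) ^ (2\<^sup>j - 1)\<close>,
  and the left-hand factor stays bounded as \<open>j\<close> grows.\<close>

lemma abs_monom_square_le: "\<bar>L (monom 1 n * (q * q))\<bar> \<le> L (q * q)"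
proof -
  define a where "a n = L (monom 1 n * (q * q))" for n
  have a0: "a 0 = L (q * q)" by (simp add: a_def flip: one_poly_eq_simps)
  have a0_nonneg: "a 0 \<ge> 0" by (simp add: a0 square_nonneg)
  have step: "(a n)\<^sup>2 \<le> a 0 * a (2 * n)" for n
  proof -
    have "q * (monom 1 n * q) = monom 1 n * (q * q)"
      and "(monom 1 n * q) * (monom 1 n * q) = monom 1 (2 * n) * (q * q)"
      by (simp_all add: mult_ac mult_monom mult_2_right)
    from Cauchy_Schwarz[of q "monom 1 n * q", unfolded this] show ?thesis
      unfolding a0 by (simp only: a_def)
  qed
  obtain B where B: "\<And>n. \<bar>a n\<bar> \<le> B"
  proof
    fix n
    have "a n = (\<Sum>i\<le>n. if i = n then \<Sum>j\<le>degree (q * q). coeff (q * q) j * m (n + j) else 0)"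
      unfolding a_def moment_functional_mult[of m "monom 1 n"]
      by (intro sum.cong) (auto simp: degree_monom_eq)
    then have "a n = (\<Sum>j\<le>degree (q * q). coeff (q * q) j * m (n + j))"
      by simp
    also have "\<bar>\<dots>\<bar> \<le> (\<Sum>j\<le>degree (q * q). \<bar>coeff (q * q) j\<bar> * K)"
      by (intro order_trans[OF sum_abs] sum_mono) (auto simp: abs_mult intro!: mult_left_mono moment_bound)
    finally show "\<bar>a n\<bar> \<le> (\<Sum>j\<le>degree (q * q). \<bar>coeff (q * q) j\<bar> * K)" .
  qed
  show ?thesis
  proof (cases "a 0 = 0")
    case True
    with step[of n] have "a n = 0" by simp
    then show ?thesis using a0_nonneg by (simp only: a_def[symmetric] a0[symmetric])
  next
    case False
    with a0_nonneg have pos: "a 0 > 0" by simp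
    have iter: "(\<bar>a n\<bar> / a 0) ^ (2 ^ j) \<le> \<bar>a (n * 2 ^ j)\<bar> / a 0" for j
    proof (induction j)
      case (Suc j)
      have "(\<bar>a n\<bar> / a 0) ^ (2 ^ Suc j) = ((\<bar>a n\<bar> / a 0) ^ (2 ^ j))\<^sup>2"
        by (simp add: power_mult[symmetric] mult.commute)
      also have "\<dots> \<le> (\<bar>a (n * 2 ^ j)\<bar> / a 0)\<^sup>2"
        using pos by (intro power_mono Suc.IH) simp
      also have "\<dots> = (a (n * 2 ^ j))\<^sup>2 / (a 0)\<^sup>2"
        by (simp add: power_divide)
      also have "\<dots> \<le> (a 0 * a (2 * (n * 2 ^ j))) / (a 0)\<^sup>2"
        by (intro divide_right_mono step) simp
      also have "\<dots> = a (n * 2 ^ Suc j) / a 0"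
        using pos by (simp add: power2_eq_square mult_ac)
      also have "\<dots> \<le> \<bar>a (n * 2 ^ Suc j)\<bar> / a 0"
        using pos by (intro divide_right_mono) auto
      finally show ?case .
    qed simp
    have "\<bar>a n\<bar> / a 0 \<le> 1"
    proof (rule ccontr)
      assume "\<not> ?thesis"
      then have gt: "\<bar>a n\<bar> / a 0 > 1" by simp
      from real_arch_pow[OF gt, of "B / a 0"] obtain k where "B / a 0 < (\<bar>a n\<bar> / a 0) ^ k" by auto
      also have "\<dots> \<le> (\<bar>a n\<bar> / a 0) ^ (2 ^ k)"
        using gt by (intro power_increasing less_imp_le[OF less_exp]) auto
      also have "\<dots> \<le> B / a 0"
        using order_trans[OF iter divide_right_mono[OF B]] pos by simp
      finally show False by simp
    qed
    then show ?thesis using pos by (simp only: a_def[symmetric] a0[symmetric]) simp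
  qed
qed

text \<open>The weights 1 + x, 1 - x and 1 - x^2 are the ones that cut out [-1, 1]. Each inequality
  is the preceding estimate for \<open>x^n q^2\<close>, with \<open>n\<close> equal to 1, 1 and
  2.\<close>

lemma weighted_square_nonneg:
  "L ([:1, 1:] * (q * q)) \<ge> 0" "L ([:1, -1:] * (q * q)) \<ge> 0" "L ([:1, 1:] * [:1, -1:] * (q * q)) \<ge> 0"
proof -
  have x: "monom 1 1 = [:0, 1 :: real:]" "monom 1 2 = [:0, 0, 1 :: real:]"
    by (simp_all add: monom_altdef power2_eq_square)
  have e: "[:1, 1:] * (q * q) = q * q + monom 1 1 * (q * q)"
    unfolding x by simp
  show "L ([:1, 1:] * (q * q)) \<ge> 0"
    using abs_monom_square_le[of 1 q] unfolding e moment_functional_add by linarith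
  have e: "[:1, -1:] * (q * q) = q * q - monom 1 1 * (q * q)"
    unfolding x by simp
  show "L ([:1, -1:] * (q * q)) \<ge> 0"
    using abs_monom_square_le[of 1 q] unfolding e moment_functional_diff by linarith
  have e: "[:1, 1:] * [:1, -1:] * (q * q) = q * q - monom 1 2 * (q * q)"
    unfolding x by simp
  show "L ([:1, 1:] * [:1, -1:] * (q * q)) \<ge> 0"
    using abs_monom_square_le[of 2 q] unfolding e moment_functional_diff by linarith
qed

text \<open>The even parts of the exponents form a square, and the factor left in front of it is 1
  or one of the three weights.\<close>

lemma product_nonneg: "L ([:1, 1:] ^ k * [:1, -1:] ^ l) \<ge> 0"
proof -
  define u v where "u = [:1, 1 :: real:]" and "v = [:1, -1 :: real:]"
  define q where "q = u ^ (k div 2) * v ^ (l div 2)"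
  have split: "p ^ n = p ^ (n mod 2) * (p ^ (n div 2) * p ^ (n div 2))" for p :: "real poly" and n
    by (metis mod_mult_div_eq mult.commute mult_2_right power_add add.commute)
  have "u ^ k * v ^ l = u ^ (k mod 2) * v ^ (l mod 2) * (q * q)"
    by (subst split[of u], subst split[of v]) (simp only: q_def mult_ac)
  moreover have "k mod 2 = 0 \<or> k mod 2 = 1" "l mod 2 = 0 \<or> l mod 2 = 1" by auto
  ultimately show ?thesis
    using weighted_square_nonneg[of q] square_nonneg[of q]
    by (auto simp flip: u_def v_def)
qed


text \<open>The nodes and weights of the Bernstein operator transported from \<open>[0, 1]\<close> to \<open>[-1, 1]\<close>.\<close>

definition node :: "nat \<Rightarrow> nat \<Rightarrow> real"
  where "node n k = 2 * (real k / real n) - 1"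

definition node_weight :: "nat \<Rightarrow> nat \<Rightarrow> real"
  where "node_weight n k = L (of_nat (n choose k) * ([:1/2, 1/2:] ^ k * [:1/2, -1/2:] ^ (n - k)))"

lemma node_weight_nonneg: "node_weight n k \<ge> 0"
proof -
  have "[:1/2, 1/2:] = smult (1/2) [:1, 1::real:]" "[:1/2, -1/2:] = smult (1/2) [:1, -1::real:]"
    by simp_all
  then have "of_nat (n choose k) * ([:1/2, 1/2:] ^ k * [:1/2, -1/2:] ^ (n - k))
    = smult (real (n choose k) * (1/2) ^ k * (1/2) ^ (n - k)) ([:1, 1:] ^ k * [:1, -1:] ^ (n - k))"
    by (simp only: smult_power of_nat_poly) (simp add: mult_ac)
  then show ?thesis
    by (simp add: node_weight_def moment_functional_smult product_nonneg)
qed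

text \<open>Factorial moments are reproduced exactly, so the power moments only need the elementary
  estimate of the ratio of the two.\<close>

lemma sum_node_weight_choose:
  assumes "i \<le> n"
  shows "(\<Sum>k\<le>n. node_weight n k * (real (k choose i) / real (n choose i))) = L ([:1/2, 1/2:] ^ i)"
proof -
  have nz: "real (n choose i) \<noteq> 0" using assms by simp
  have "(\<Sum>k\<le>n. node_weight n k * real (k choose i))
    = L (\<Sum>k\<le>n. of_nat ((n choose k) * (k choose i)) * ([:1/2, 1/2:] ^ k * [:1/2, -1/2:] ^ (n - k)))"
    unfolding node_weight_def moment_functional_sum
    by (intro sum.cong refl) (simp add: of_nat_poly moment_functional_smult mult_ac)
  also have "\<dots> = L (of_nat (n choose i) * [:1/2, 1/2:] ^ i)"
    by (subst sum_binomial_choose[OF assms]) (simp flip: one_pCons)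
  also have "\<dots> = real (n choose i) * L ([:1/2, 1/2:] ^ i)"
    by (simp add: of_nat_poly moment_functional_smult)
  finally show ?thesis
    using nz by (simp add: field_simps flip: sum_divide_distrib)
qed

lemma sum_node_weight: "(\<Sum>k\<le>n. node_weight n k) = m 0"
  using sum_node_weight_choose[of 0 n] moment_functional_monom[of m 1 0] by simp

text \<open>The factorial version of this average equals the limit for every
  \<open>n \<ge> i\<close>. The replacement of factorial by ordinary powers costs an error uniform
  in \<open>k\<close>, and the total mass of the weights is always \<open>m 0\<close>.\<close>

lemma node_weight_moment_tendsto:
  "(\<lambda>n. \<Sum>k\<le>n. node_weight n k * (real k / real n) ^ i) \<longlonglongrightarrow> L ([:1/2, 1/2:] ^ i)"
proof (rule Lim_transform_bound[THEN Lim_null[THEN iffD2]])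
  let ?e = "\<lambda>n. real i * (real i / real (n - i))"
  show "(\<lambda>n. m 0 * ?e n) \<longlonglongrightarrow> 0"
  proof -
    have "filterlim (\<lambda>n. real (n - i)) at_top sequentially"
      by (intro filterlim_compose[OF filterlim_real_sequentially] filterlim_minus_const_nat_at_top)
    then show ?thesis by real_asymp
  qed
  show "\<forall>\<^sub>F n in sequentially. norm ((\<Sum>k\<le>n. node_weight n k * (real k / real n) ^ i) - L ([:1/2, 1/2:] ^ i)) \<le> norm (m 0 * ?e n)"
    using eventually_ge_at_top[of "2 * i + 1"]
  proof eventually_elim
    case (elim n)
    have "norm ((\<Sum>k\<le>n. node_weight n k * (real k / real n) ^ i) - L ([:1/2, 1/2:] ^ i))
      = norm (\<Sum>k\<le>n. node_weight n k * (real (k choose i) / real (n choose i) - (real k / real n) ^ i))"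
      using elim by (subst sum_node_weight_choose[of i n, symmetric])
        (simp_all add: right_diff_distrib norm_minus_commute sum_subtractf abs_minus_commute)
    also have "\<dots> \<le> (\<Sum>k\<le>n. node_weight n k * ?e n)"
      using elim choose_quotient_approx[of i n] node_weight_nonneg
      by (intro order_trans[OF norm_sum] sum_mono)
         (simp only: norm_mult real_norm_def abs_mult abs_of_nonneg atMost_iff mult_left_mono)
    also have "\<dots> = m 0 * ?e n"
      by (simp only: sum_node_weight flip: sum_distrib_right)
    also have "\<dots> \<le> norm (m 0 * ?e n)" unfolding real_norm_def by (rule abs_ge_self)
    finally show ?case .
  qed
qed

text \<open>A node is \<open>2 t - 1\<close> with \<open>t = k / n\<close>, and
  \<open>x = 2 y - 1\<close> with \<open>y = (1 + x) / 2\<close>. Expanding both \<open>i\<close>-th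
  powers with the same coefficients reduces the claim to the averages of
  \<open>t ^ j\<close>.\<close>

lemma node_moment_tendsto: "(\<lambda>n. \<Sum>k\<le>n. node_weight n k * node n k ^ i) \<longlonglongrightarrow> m i"
proof -
  define y where "y = [:1/2, 1/2::real:]"
  have binom: "(2 * t - 1) ^ i = (\<Sum>j\<le>i. (real (i choose j) * 2 ^ j * (-1) ^ (i - j)) * t ^ j)" for t :: real
    using binomial_ring[of "2 * t" "-1" i] by (simp add: power_mult_distrib mult_ac)
  have "monom 1 i = (smult 2 y + (-1)) ^ i"
    by (simp add: y_def monom_altdef one_pCons)
  also have "\<dots> = (\<Sum>j\<le>i. smult (real (i choose j) * 2 ^ j * (-1) ^ (i - j)) (y ^ j))"
  proof -
    have "(-1 :: real poly) ^ j = [:(-1) ^ j:]" for j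
      by (induction j) (auto simp: one_pCons)
    then show ?thesis
      by (subst binomial_ring) (simp add: smult_power of_nat_poly mult_ac)
  qed
  finally have "m i = (\<Sum>j\<le>i. (real (i choose j) * 2 ^ j * (-1) ^ (i - j)) * L (y ^ j))"
    using moment_functional_monom[of m 1 i]
    by (simp add: moment_functional_sum moment_functional_smult)
  moreover have "(\<Sum>k\<le>n. node_weight n k * node n k ^ i)
    = (\<Sum>j\<le>i. (real (i choose j) * 2 ^ j * (-1) ^ (i - j)) * (\<Sum>k\<le>n. node_weight n k * (real k / real n) ^ j))" for n
    unfolding node_def binom sum_distrib_left
    by (subst sum.swap) (simp add: mult_ac)
  ultimately show ?thesis
    using node_weight_moment_tendsto
    by (auto simp: y_def intro!: tendsto_sum tendsto_mult_left)
qed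

section \<open>Weak limits of the discrete measures\<close>

lemma exists_representing_prob:
  assumes "m 0 > 0"
  shows "\<exists>M. real_distribution M \<and> (AE x in M. \<bar>x\<bar> \<le> 1) \<and> (\<forall>k. (\<integral>x. x ^ k \<partial>M) = m k / m 0)"
proof -
  \<comment> \<open>Division by \<open>m 0\<close> yields probability measures, as required for
    selecting a weakly convergent subsequence; \<open>Suc n\<close> keeps the denominator of the
    nodes positive.\<close>
  define D where "D n = distr (point_measure {..Suc n} (\<lambda>k. node_weight (Suc n) k / m 0)) borel (node (Suc n))" for n
  have nonneg: "node_weight n k / m 0 \<ge> 0" for n k
    using node_weight_nonneg assms by simp
  have node_meas: "node (Suc n) \<in> measurable (point_measure {..Suc n} (\<lambda>k. node_weight (Suc n) k / m 0)) borel" for n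
    by (simp add: point_measure_def)
  have prob: "real_distribution (D n)" for n
  proof -
    have "prob_space (point_measure {..Suc n} (\<lambda>k. ennreal (node_weight (Suc n) k / m 0)))"
      by (rule prob_space_point_measure)
         (use nonneg assms in \<open>simp_all add: sum_node_weight del: sum.atMost_Suc flip: sum_divide_distrib\<close>)
    then have "prob_space (D n)"
      unfolding D_def by (rule prob_space.prob_space_distr) (rule node_meas)
    then show ?thesis
      by (simp add: real_distribution_def real_distribution_axioms_def D_def)
  qed
  have integral_D: "(\<integral>x. f x \<partial>D n) = (\<Sum>k\<le>Suc n. (node_weight (Suc n) k / m 0) * f (node (Suc n) k))"
    if "f \<in> borel_measurable borel" for f :: "real \<Rightarrow> real" and n
    unfolding D_def using that nonneg
    by (subst integral_distr[OF node_meas]) (simp_all add: lebesgue_integral_point_measure_finite)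
  have node_bound: "\<bar>node (Suc n) k\<bar> \<le> 1" if "k \<le> Suc n" for n k
    using that by (simp add: node_def abs_le_iff field_simps)
  have "tight D"
    unfolding tight_def
  proof (intro conjI allI impI prob)
    fix \<epsilon> :: real assume "\<epsilon> > 0"
    \<comment> \<open>Tightness is phrased with half-open intervals, so the left end lies below -1
      to keep the node -1 inside.\<close>
    have "measure (D n) {-2<..1} = 1" for n
    proof -
      interpret real_distribution "D n" by (rule prob)
      have "measure (D n) {-2<..1} = (\<integral>x. indicator {-2<..1} x \<partial>D n)"
        by simp
      also have "\<dots> = (\<Sum>k\<le>Suc n. (node_weight (Suc n) k / m 0) * 1)"
      proof (subst integral_D)
        show "(\<Sum>k\<le>Suc n. node_weight (Suc n) k / m 0 * indicator {-2<..1} (node (Suc n) k))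
          = (\<Sum>k\<le>Suc n. (node_weight (Suc n) k / m 0) * 1)"
        proof (rule sum.cong[OF refl])
          fix k assume "k \<in> {..Suc n}"
          then show "node_weight (Suc n) k / m 0 * indicator {-2<..1} (node (Suc n) k) = node_weight (Suc n) k / m 0 * 1"
            using node_bound[of k n] by (auto simp: indicator_def abs_le_iff)
        qed
      qed simp
      also have "\<dots> = 1"
        using assms by (simp only: mult_1_right sum_node_weight flip: sum_divide_distrib) simp
      finally show ?thesis .
    qed
    then show "\<exists>a b. a < b \<and> (\<forall>n. 1 - \<epsilon> < measure (D n) {a<..b})"
      using \<open>\<epsilon> > 0\<close> by (intro exI[of _ "-2"] exI[of _ 1]) auto
  qed
  from tight_imp_convergent_subsubsequence[OF this strict_mono_id]
  obtain r M where r: "strict_mono (r :: nat \<Rightarrow> nat)" and M: "real_distribution M"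
    and conv: "weak_conv_m (D \<circ> r) M"
    by (auto simp only: comp_id)
  have weak: "(\<lambda>n. \<integral>x. f x \<partial>D (r n)) \<longlonglongrightarrow> (\<integral>x. f x \<partial>M)"
    if "continuous_on UNIV f" "\<And>x. \<bar>f x\<bar> \<le> B" for f :: "real \<Rightarrow> real" and B
    using weak_conv_imp_integral_bdd_continuous_conv[of "D \<circ> r" M f B] prob M conv that
    by (auto simp: continuous_on_eq_continuous_at)
  interpret M: real_distribution M by (rule M)
  have supp: "AE x in M. \<bar>x\<bar> \<le> 1"
  proof -
    \<comment> \<open>A bounded continuous function that vanishes exactly on [-1, 1]: its integral
      is 0 along the sequence, hence in the limit, which locates the support.\<close>
    define f :: "real \<Rightarrow> real" where "f x = min 1 (max 0 (\<bar>x\<bar> - 1))" for x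
    have f: "continuous_on UNIV f" "f \<in> borel_measurable borel" "\<And>x. \<bar>f x\<bar> \<le> 1" "\<And>x. f x \<ge> 0"
      unfolding f_def by (auto intro!: continuous_intros)
    have "(\<integral>x. f x \<partial>D n) = 0" for n
      using node_bound[of _ n] by (subst integral_D[OF f(2)]) (auto simp: f_def intro!: sum.neutral)
    then have "(\<integral>x. f x \<partial>M) = 0"
      using weak[OF f(1,3)] by (simp add: LIMSEQ_const_iff)
    then have "AE x in M. f x = 0"
      using f by (subst (asm) integral_nonneg_eq_0_iff_AE) (auto intro!: M.integrable_const_bound[of _ 1])
    then show ?thesis
      by eventually_elim (auto simp: f_def min_def max_def split: if_splits)
  qed
  have "(\<integral>x. x ^ k \<partial>M) = m k / m 0" for k
  proof -
    \<comment> \<open>Clamping makes the power bounded, as weak convergence demands, and changes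
      nothing on [-1, 1], which carries all these measures.\<close>
    define f :: "real \<Rightarrow> real" where "f x = (max (-1) (min 1 x)) ^ k" for x
    have f: "continuous_on UNIV f" "f \<in> borel_measurable borel"
      unfolding f_def by (auto intro!: continuous_intros)
    have bound: "\<bar>f x\<bar> \<le> 1" for x
      unfolding f_def power_abs by (rule power_le_one) auto
    have f_eq: "f x = x ^ k" if "\<bar>x\<bar> \<le> 1" for x
      using that by (auto simp: f_def min_def max_def abs_le_iff)
    have "(\<integral>x. f x \<partial>D n) = (\<Sum>k'\<le>Suc n. node_weight (Suc n) k' * node (Suc n) k' ^ k) / m 0" for n
      unfolding integral_D[OF f(2)] sum_divide_distrib
      by (intro sum.cong refl) (simp add: f_eq node_bound)
    then have "(\<lambda>n. \<integral>x. f x \<partial>D n) \<longlonglongrightarrow> m k / m 0"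
      using LIMSEQ_Suc[OF node_moment_tendsto[of k]] assms
      by (auto intro!: tendsto_divide)
    then have "(\<lambda>n. \<integral>x. f x \<partial>D (r n)) \<longlonglongrightarrow> m k / m 0"
      using LIMSEQ_subseq_LIMSEQ[OF _ r] by (auto simp: o_def)
    then have "(\<integral>x. f x \<partial>M) = m k / m 0"
      using weak[OF f(1) bound] by (rule LIMSEQ_unique[rotated])
    moreover have "(\<integral>x. f x \<partial>M) = (\<integral>x. x ^ k \<partial>M)"
      using supp f by (intro integral_cong_AE) (auto simp: f_eq)
    ultimately show ?thesis by simp
  qed
  with M supp show ?thesis
    by (intro exI[of _ M] conjI allI)
qed

text \<open>If \<open>m 0 = 0\<close>, the estimate for \<open>x^k q^2\<close> at
  \<open>q = 1\<close> makes every moment 0 and the null measure serves; otherwise the representing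
  probability is rescaled by \<open>m 0\<close>.\<close>

theorem exists_representing_measure:
  "\<exists>M. finite_measure M \<and> sets M = sets borel \<and> (AE x in M. \<bar>x\<bar> \<le> 1) \<and> (\<forall>k. (\<integral>x. x ^ k \<partial>M) = m k)"
proof (cases "m 0 = 0")
  case True
  have "L (1 * 1) = m 0"
    using moment_functional_monom[of m 1 0] by simp
  then have "m k = 0" for k
    using abs_monom_square_le[of k 1] moment_functional_monom[of m 1 k] True by simp
  then show ?thesis
    by (intro exI[of _ "null_measure borel"]) (auto intro: finite_measureI simp: AE_iff_null null_sets_def)
next
  case False
  have "m 0 \<ge> 0"
    using square_nonneg[of 1] moment_functional_monom[of m 1 0] by simp
  with False have pos: "m 0 > 0" by simp
  then obtain M where M: "real_distribution M" "AE x in M. \<bar>x\<bar> \<le> 1" "\<And>k. (\<integral>x. x ^ k \<partial>M) = m k / m 0"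
    using exists_representing_prob[OF pos] by auto
  interpret M: real_distribution M by (rule M)
  let ?N = "density M (\<lambda>_. ennreal (m 0))"
  have "finite_measure ?N"
    by (rule finite_measureI) (simp add: emeasure_density ennreal_mult_eq_top_iff)
  moreover have "AE x in ?N. \<bar>x\<bar> \<le> 1"
    using M(2) by (auto simp: AE_density)
  moreover have "(\<integral>x. x ^ k \<partial>?N) = m k" for k
    using pos M(3)[of k] by (subst integral_density) auto
  ultimately show ?thesis
    by (intro exI[of _ ?N]) auto
qed

end

subsection \<open>Complex densities and their integrals\<close>

text \<open>Identities such as those for real parts of set integrals are available only on Borel
  sets; the Jordan parts depend on no other values.\<close>

lemma pos_part_cong:
  assumes "\<And>E. E \<in> sets borel \<Longrightarrow> \<mu> E = \<nu> E"
  shows "pos_part \<mu> = pos_part \<nu>"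
  unfolding pos_part_def using assms
  by (intro measure_of_eq) (auto intro!: SUP_cong)

lemma neg_part_cong:
  assumes "\<And>E. E \<in> sets borel \<Longrightarrow> \<mu> E = \<nu> E"
  shows "neg_part \<mu> = neg_part \<nu>"
  unfolding neg_part_def using assms by (intro pos_part_cong) auto

locale compactly_supported_measure = finite_measure \<rho> for \<rho> :: "real measure" +
  assumes sets_borel [simp, measurable_cong]: "sets \<rho> = sets borel"
    and support: "AE x in \<rho>. \<bar>x\<bar> \<le> 1"
begin

lemma space_UNIV [simp]: "space \<rho> = UNIV"
  using sets_eq_imp_space_eq[OF sets_borel] by simp

text \<open>The continuous factor is bounded on [-1, 1], which carries the measure, so a multiple of
  \<open>norm (w x)\<close> dominates the product.\<close>

lemma integrable_continuous_mult:
  fixes f w :: "real \<Rightarrow> 'b :: {real_normed_field, banach, second_countable_topology}"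
  assumes f: "continuous_on UNIV f" and w: "integrable \<rho> w"
  shows "integrable \<rho> (\<lambda>x. f x * w x)"
proof -
  have "compact (f ` {-1..1})"
    using f by (intro compact_continuous_image) (auto intro: continuous_on_subset)
  then obtain B where B: "\<And>x. x \<in> {-1..1} \<Longrightarrow> norm (f x) \<le> B"
    by (fastforce dest!: compact_imp_bounded simp: bounded_iff)
  have fm: "f \<in> borel_measurable \<rho>"
    using borel_measurable_continuous_onI[OF f] by simp
  show ?thesis
  proof (rule Bochner_Integration.integrable_bound)
    show "integrable \<rho> (\<lambda>x. B * norm (w x))"
      using w by simp
    show "AE x in \<rho>. norm (f x * w x) \<le> norm (B * norm (w x))"
      using support
    proof eventually_elim
      case (elim x)
      then have "norm (f x) \<le> \<bar>B\<bar>" using B[of x] by (auto simp: abs_le_iff)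
      then show ?case by (simp add: norm_mult abs_mult mult_right_mono)
    qed
  qed (use fm w in simp)
qed

text \<open>Among the Borel subsets of \<open>E\<close>, the Hahn set
  \<open>E \<inter> {x. h x \<ge> 0}\<close> attains the supremum in \<open>pos_part\<close>, and
  \<open>ennreal\<close> truncates \<open>h\<close> to its positive part.\<close>

lemma pos_part_set_integral:
  assumes h: "integrable \<rho> h"
  shows "pos_part (\<lambda>E. LINT x:E|\<rho>. h x) = density \<rho> (\<lambda>x. ennreal (h x))"
proof -
  have hm [measurable]: "h \<in> borel_measurable \<rho>" using h by simp
  have sup: "(SUP F\<in>{F \<in> sets borel. F \<subseteq> E}. ennreal (LINT x:F|\<rho>. h x))
      = emeasure (density \<rho> (\<lambda>x. ennreal (h x))) E" if E: "E \<in> sets borel" for E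
  proof (rule antisym)
    have eq: "emeasure (density \<rho> (\<lambda>x. ennreal (h x))) E = (\<integral>\<^sup>+x. ennreal (h x) * indicator E x \<partial>\<rho>)"
      using E by (subst emeasure_density) auto
    show "(SUP F\<in>{F \<in> sets borel. F \<subseteq> E}. ennreal (LINT x:F|\<rho>. h x)) \<le> emeasure (density \<rho> (\<lambda>x. ennreal (h x))) E"
    proof (rule SUP_least)
      fix F assume "F \<in> {F \<in> sets borel. F \<subseteq> E}"
      then have F: "F \<in> sets borel" "F \<subseteq> E" by auto
      have int: "integrable \<rho> (\<lambda>x. indicator F x *\<^sub>R max 0 (h x))"
        using h F by (intro integrable_mult_indicator Bochner_Integration.integrable_max) auto
      have "(LINT x:F|\<rho>. h x) \<le> (\<integral>x. indicator F x *\<^sub>R max 0 (h x) \<partial>\<rho>)"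
        unfolding set_lebesgue_integral_def using h F
        by (intro integral_mono int integrable_mult_indicator) (auto simp: indicator_def)
      then have "ennreal (LINT x:F|\<rho>. h x) \<le> ennreal (\<integral>x. indicator F x *\<^sub>R max 0 (h x) \<partial>\<rho>)"
        by (rule ennreal_leI)
      also have "\<dots> = (\<integral>\<^sup>+x. ennreal (indicator F x *\<^sub>R max 0 (h x)) \<partial>\<rho>)"
        by (rule nn_integral_eq_integral[OF int, symmetric]) (auto simp: indicator_def)
      also have "\<dots> \<le> (\<integral>\<^sup>+x. ennreal (h x) * indicator E x \<partial>\<rho>)"
        using F by (intro nn_integral_mono) (auto simp: indicator_def max_def)
      finally show "ennreal (LINT x:F|\<rho>. h x) \<le> emeasure (density \<rho> (\<lambda>x. ennreal (h x))) E"
        by (simp only: eq)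
    qed
    define F where "F = E \<inter> {x. h x \<ge> 0}"
    have "{x \<in> space \<rho>. h x \<ge> 0} \<in> sets \<rho>" by measurable
    then have F: "F \<in> sets borel" "F \<subseteq> E" using E by (auto simp: F_def)
    have "emeasure (density \<rho> (\<lambda>x. ennreal (h x))) E = (\<integral>\<^sup>+x. ennreal (indicator F x *\<^sub>R h x) \<partial>\<rho>)"
      unfolding eq by (intro nn_integral_cong) (auto simp: F_def indicator_def ennreal_neg)
    also have "\<dots> = ennreal (LINT x:F|\<rho>. h x)"
      unfolding set_lebesgue_integral_def using h F
      by (intro nn_integral_eq_integral integrable_mult_indicator) (auto simp: F_def indicator_def)
    also have "\<dots> \<le> (SUP F\<in>{F \<in> sets borel. F \<subseteq> E}. ennreal (LINT x:F|\<rho>. h x))"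
      using F by (intro SUP_upper) auto
    finally show "emeasure (density \<rho> (\<lambda>x. ennreal (h x))) E
        \<le> (SUP F\<in>{F \<in> sets borel. F \<subseteq> E}. ennreal (LINT x:F|\<rho>. h x))" .
  qed
  have "pos_part (\<lambda>E. LINT x:E|\<rho>. h x)
      = measure_of UNIV (sets borel) (emeasure (density \<rho> (\<lambda>x. ennreal (h x))))"
    unfolding pos_part_def
    by (rule measure_of_eq) (auto simp: sup sets.sigma_sets_eq[of borel, simplified])
  also have "\<dots> = density \<rho> (\<lambda>x. ennreal (h x))"
    using measure_of_of_measure[of "density \<rho> (\<lambda>x. ennreal (h x))"] by simp
  finally show ?thesis .
qed

lemma neg_part_set_integral:
  assumes h: "integrable \<rho> h"
  shows "neg_part (\<lambda>E. LINT x:E|\<rho>. h x) = density \<rho> (\<lambda>x. ennreal (- h x))"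
proof -
  have "(\<lambda>E. - (LINT x:E|\<rho>. h x)) = (\<lambda>E. LINT x:E|\<rho>. - h x)"
    by (simp add: set_lebesgue_integral_def)
  then show ?thesis
    unfolding neg_part_def using pos_part_set_integral[of "\<lambda>x. - h x"] h by simp
qed

lemma integrable_density_continuous:
  fixes f :: "real \<Rightarrow> 'b :: {real_normed_field, banach, second_countable_topology}"
  assumes f: "continuous_on UNIV f" and h: "integrable \<rho> h"
  shows "integrable (density \<rho> (\<lambda>x. ennreal (h x))) f"
    and "integral\<^sup>L (density \<rho> (\<lambda>x. ennreal (h x))) f = (\<integral>x. f x * of_real (max 0 (h x)) \<partial>\<rho>)"
    and "integrable \<rho> (\<lambda>x. f x * of_real (max 0 (h x)))"
proof -
  have fm: "f \<in> borel_measurable \<rho>"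
    using borel_measurable_continuous_onI[OF f] by simp
  have hm: "(\<lambda>x. max 0 (h x)) \<in> borel_measurable \<rho>"
    using h by simp
  have "integrable \<rho> (\<lambda>x. max 0 (h x))"
    using h by (intro Bochner_Integration.integrable_max) auto
  then have "integrable \<rho> (\<lambda>x. of_real (max 0 (h x)) :: 'b)"
    by (rule integrable_of_real)
  then show *: "integrable \<rho> (\<lambda>x. f x * of_real (max 0 (h x)))"
    by (rule integrable_continuous_mult[OF f])
  have eq: "density \<rho> (\<lambda>x. ennreal (h x)) = density \<rho> (\<lambda>x. ennreal (max 0 (h x)))"
    by (simp add: ennreal_max_0)
  show "integrable (density \<rho> (\<lambda>x. ennreal (h x))) f"
    unfolding eq using * by (subst integrable_density[OF fm hm]) (auto simp: scaleR_conv_of_real mult.commute)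
  show "integral\<^sup>L (density \<rho> (\<lambda>x. ennreal (h x))) f = (\<integral>x. f x * of_real (max 0 (h x)) \<partial>\<rho>)"
    unfolding eq by (subst integral_density[OF fm hm]) (auto simp: scaleR_conv_of_real mult.commute)
qed

lemma signed_integral_set_integral:
  assumes f: "continuous_on UNIV f" and h: "integrable \<rho> h"
  shows "signed_integral (\<lambda>E. LINT x:E|\<rho>. h x) f = (\<integral>x. f x * of_real (h x) \<partial>\<rho>)"
proof -
  have h': "integrable \<rho> (\<lambda>x. - h x)" using h by simp
  have "signed_integral (\<lambda>E. LINT x:E|\<rho>. h x) f
    = (\<integral>x. f x * of_real (max 0 (h x)) - f x * of_real (max 0 (- h x)) \<partial>\<rho>)"
    unfolding signed_integral_def pos_part_set_integral[OF h] neg_part_set_integral[OF h]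
    using integrable_density_continuous[OF f h] integrable_density_continuous[OF f h'] by simp
  also have "\<dots> = (\<integral>x. f x * of_real (h x) \<partial>\<rho>)"
    by (intro Bochner_Integration.integral_cong) (auto simp: max_def)
  finally show ?thesis .
qed

lemma Re_Im_set_integral:
  assumes w: "integrable \<rho> w" and E: "E \<in> sets borel"
  shows "Re (LINT x:E|\<rho>. w x) = (LINT x:E|\<rho>. Re (w x))"
    and "Im (LINT x:E|\<rho>. w x) = (LINT x:E|\<rho>. Im (w x))"
  using integrable_mult_indicator[of E \<rho> w] w E
  by (auto simp: set_lebesgue_integral_def simp flip: integral_Re integral_Im)


lemma integrable_Re_Im:
  assumes "integrable \<rho> w"
  shows "integrable \<rho> (\<lambda>x. Re (w x))" and "integrable \<rho> (\<lambda>x. Im (w x))"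
  using assms by auto

lemma pos_neg_part_complex_density:
  assumes w: "integrable \<rho> w"
  shows "pos_part (\<lambda>E. Re (LINT x:E|\<rho>. w x)) = pos_part (\<lambda>E. LINT x:E|\<rho>. Re (w x))"
    and "neg_part (\<lambda>E. Re (LINT x:E|\<rho>. w x)) = neg_part (\<lambda>E. LINT x:E|\<rho>. Re (w x))"
    and "pos_part (\<lambda>E. Im (LINT x:E|\<rho>. w x)) = pos_part (\<lambda>E. LINT x:E|\<rho>. Im (w x))"
    and "neg_part (\<lambda>E. Im (LINT x:E|\<rho>. w x)) = neg_part (\<lambda>E. LINT x:E|\<rho>. Im (w x))"
  by (intro pos_part_cong neg_part_cong Re_Im_set_integral[OF w]; assumption)+

text \<open>The Jordan parts are the densities of the positive and negative parts of
  \<open>Re w\<close> and \<open>Im w\<close>, and their four integrals recombine. Afterwards the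
  integral is visibly linear in the density.\<close>

lemma cm_integral_density:
  assumes f: "continuous_on UNIV f" and w: "integrable \<rho> w"
  shows "cm_integral (\<lambda>E. LINT x:E|\<rho>. w x) f = (\<integral>x. f x * w x \<partial>\<rho>)"
proof -
  note int = integrable_Re_Im[OF w]
  note int_mult = int[THEN integrable_of_real, THEN integrable_continuous_mult[OF f]]
  have "cm_integral (\<lambda>E. LINT x:E|\<rho>. w x) f
    = (\<integral>x. f x * of_real (Re (w x)) \<partial>\<rho>) + \<i> * (\<integral>x. f x * of_real (Im (w x)) \<partial>\<rho>)"
    using signed_integral_set_integral[OF f int(1)] signed_integral_set_integral[OF f int(2)]
    by (simp only: cm_integral_def signed_integral_def pos_neg_part_complex_density[OF w])
  also have "\<dots> = (\<integral>x. f x * of_real (Re (w x)) + \<i> * (f x * of_real (Im (w x))) \<partial>\<rho>)"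
    using int_mult by simp
  also have "\<dots> = (\<integral>x. f x * w x \<partial>\<rho>)"
  proof (rule Bochner_Integration.integral_cong[OF refl])
    fix x
    have "w x = of_real (Re (w x)) + \<i> * of_real (Im (w x))" by (rule complex_eq)
    then show "f x * of_real (Re (w x)) + \<i> * (f x * of_real (Im (w x))) = f x * w x"
      by (metis distrib_left mult.left_commute)
  qed
  finally show ?thesis .
qed

lemma finite_moments_density:
  assumes w: "integrable \<rho> w"
  shows "finite_moments (\<lambda>E. LINT x:E|\<rho>. w x)"
proof -
  note int = integrable_Re_Im[OF w]
  note int' = int[THEN Bochner_Integration.integrable_minus]
  have c: "continuous_on UNIV (\<lambda>x::real. x ^ n)" for n
    by (intro continuous_intros)
  show ?thesis
    unfolding finite_moments_def
    by (simp add: pos_neg_part_complex_density[OF w] pos_part_set_integral[OF int(1)] pos_part_set_integral[OF int(2)]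
        neg_part_set_integral[OF int(1)] neg_part_set_integral[OF int(2)]
        integrable_density_continuous(1)[OF c] int int')
qed

text \<open>Finite additivity on the partial unions, then continuity of the set integral along an
  increasing union.\<close>

lemma complex_measure_density:
  assumes w: "integrable \<rho> w"
  shows "complex_measure (\<lambda>E. LINT x:E|\<rho>. w x)"
  unfolding complex_measure_def
proof (intro allI impI)
  fix F :: "nat \<Rightarrow> real set"
  assume F: "range F \<subseteq> sets borel" and disj: "disjoint_family F"
  have Fm: "F i \<in> sets \<rho>" for i using F by auto
  have int: "set_integrable \<rho> S w" if "S \<in> sets \<rho>" for S
    unfolding set_integrable_def using that w by (rule integrable_mult_indicator)
  have ae: "AE x in \<rho>. x \<in> F i \<and> x \<in> F j \<longrightarrow> i = j" for i j
    using disj by (intro AE_I2) (auto simp: disjoint_family_on_def)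
  have "(LINT x:(\<Union>i<n. F i)|\<rho>. w x) = (\<Sum>i<n. LINT x:F i|\<rho>. w x)" for n
    using Fm int ae by (intro set_integral_finite_UN_AE) simp_all
  moreover have "(\<lambda>n. LINT x:(\<Union>i<n. F i)|\<rho>. w x) \<longlonglongrightarrow> (LINT x:(\<Union>n. \<Union>i<n. F i)|\<rho>. w x)"
  proof (intro set_integral_cont_up int)
    show "incseq (\<lambda>n. \<Union>i<n. F i)"
      unfolding incseq_def by (intro allI impI UN_mono) auto
  qed (use Fm in auto)
  moreover have "(\<Union>n. \<Union>i<n. F i) = (\<Union>n. F n)"
    by auto
  ultimately show "(\<lambda>n. LINT x:F n|\<rho>. w x) sums (LINT x:(\<Union>n. F n)|\<rho>. w x)"
    by (simp add: sums_def)
qed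

section \<open>From nonnegative integrals of squares to a nonnegative density\<close>

lemma integral_square_continuous_nonneg:
  fixes g h :: "real \<Rightarrow> real"
  assumes h: "integrable \<rho> h" and pos: "\<And>p. (\<integral>x. (poly p x)\<^sup>2 * h x \<partial>\<rho>) \<ge> 0"
    and g: "continuous_on UNIV g"
  shows "(\<integral>x. (g x)\<^sup>2 * h x \<partial>\<rho>) \<ge> 0"
proof -
  \<comment> \<open>Weierstrass is applied to \<open>g\<close> and not to its square, so that the
    squared approximants are test functions covered by \<open>pos\<close>.\<close>
  have "\<exists>p. \<forall>x\<in>{-1..1}. \<bar>g x - poly p x\<bar> < 1 / real (Suc n)" for n
  proof -
    obtain q where q: "real_polynomial_function q" "\<And>x. x \<in> {-1..1} \<Longrightarrow> \<bar>g x - q x\<bar> < 1 / real (Suc n)"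
      by (rule Stone_Weierstrass_real_polynomial_function[of "{-1..1}" g "1 / real (Suc n)"])
         (use g in \<open>auto intro: continuous_on_subset\<close>)
    from q(1) obtain a N where "q = (\<lambda>x. \<Sum>i\<le>N. a i * x ^ i)"
      by (auto simp: real_polynomial_function_iff_sum)
    then have "q = poly (\<Sum>i\<le>N. monom (a i) i)"
      by (simp add: fun_eq_iff poly_sum poly_monom)
    with q show ?thesis by blast
  qed
  then obtain p where p: "\<And>n x. x \<in> {-1..1} \<Longrightarrow> \<bar>g x - poly (p n) x\<bar> < 1 / real (Suc n)"
    by metis
  have "compact (g ` {-1..1})"
    using g by (intro compact_continuous_image) (auto intro: continuous_on_subset)
  then obtain B where B: "\<And>x. x \<in> {-1..1} \<Longrightarrow> \<bar>g x\<bar> \<le> B"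
    by (fastforce dest!: compact_imp_bounded simp: bounded_iff)
  have gm: "g \<in> borel_measurable \<rho>"
    using borel_measurable_continuous_onI[OF g] by simp
  have pm: "poly q \<in> borel_measurable \<rho>" for q :: "real poly"
    using borel_measurable_continuous_onI[of "poly q"]
    by (simp add: continuous_at_imp_continuous_on)
  have "(\<lambda>n. \<integral>x. (poly (p n) x)\<^sup>2 * h x \<partial>\<rho>) \<longlonglongrightarrow> (\<integral>x. (g x)\<^sup>2 * h x \<partial>\<rho>)"
  proof (rule integral_dominated_convergence)
    \<comment> \<open>On [-1, 1] each approximant is within distance 1 of \<open>g\<close>, hence
      bounded by \<open>B + 1\<close>.\<close>
    show "integrable \<rho> (\<lambda>x. (B + 1)\<^sup>2 * \<bar>h x\<bar>)" using h by simp
    show "AE x in \<rho>. (\<lambda>n. (poly (p n) x)\<^sup>2 * h x) \<longlonglongrightarrow> (g x)\<^sup>2 * h x"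
      using support
    proof eventually_elim
      case (elim x)
      have "(\<lambda>n. poly (p n) x) \<longlonglongrightarrow> g x"
      proof (rule Lim_transform_bound[THEN Lim_null[THEN iffD2]])
        show "\<forall>\<^sub>F n in sequentially. norm (poly (p n) x - g x) \<le> norm (1 / real (Suc n))"
        proof (intro always_eventually allI)
          fix n
          have "\<bar>g x - poly (p n) x\<bar> < 1 / real (Suc n)" using elim by (intro p) auto
          then show "norm (poly (p n) x - g x) \<le> norm (1 / real (Suc n))"
            unfolding real_norm_def by linarith
        qed
        show "(\<lambda>n. 1 / real (Suc n)) \<longlonglongrightarrow> 0"
          using LIMSEQ_inverse_real_of_nat by (simp add: inverse_eq_divide)
      qed
      then show ?case by (intro tendsto_intros)
    qed
    show "AE x in \<rho>. norm ((poly (p n) x)\<^sup>2 * h x) \<le> (B + 1)\<^sup>2 * \<bar>h x\<bar>" for n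
      using support
    proof eventually_elim
      case (elim x)
      then have x: "x \<in> {-1..1}" by auto
      have "1 / real (Suc n) \<le> 1" by simp
      then have "\<bar>poly (p n) x\<bar> \<le> B + 1"
        using p[OF x, of n] B[OF x] by linarith
      then have "\<bar>poly (p n) x\<bar>\<^sup>2 \<le> (B + 1)\<^sup>2" by (intro power_mono) auto
      then show ?case by (simp add: abs_mult mult_right_mono)
    qed
  qed (use h gm pm in simp_all)
  then show ?thesis
    by (rule LIMSEQ_le_const) (use pos in auto)
qed

lemma set_integral_compact_nonneg:
  fixes h :: "real \<Rightarrow> real"
  assumes h: "integrable \<rho> h" and pos: "\<And>p. (\<integral>x. (poly p x)\<^sup>2 * h x \<partial>\<rho>) \<ge> 0"
    and K: "compact K"
  shows "(\<integral>x. indicator K x * h x \<partial>\<rho>) \<ge> 0"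
proof (cases "K = {}")
  case False
  \<comment> \<open>For positive \<open>n\<close> this is 1 on \<open>K\<close> and 0 at distance at
    least \<open>1 / n\<close> from it, so the squares converge to the indicator. The empty set is
    treated apart because \<open>infdist x {} = 0\<close> would make \<open>g n\<close> constantly
    1.\<close>
  define g where "g n x = max 0 (1 - real n * infdist x K)" for n x
  have g: "continuous_on UNIV (g n)" for n
    unfolding g_def by (intro continuous_intros)
  have gm: "g n \<in> borel_measurable \<rho>" for n
    using borel_measurable_continuous_onI[OF g] by simp
  have Km: "K \<in> sets borel" by (intro borel_closed compact_imp_closed K)
  have "(\<lambda>n. \<integral>x. (g n x)\<^sup>2 * h x \<partial>\<rho>) \<longlonglongrightarrow> (\<integral>x. indicator K x * h x \<partial>\<rho>)"
  proof (rule integral_dominated_convergence[where w = "\<lambda>x. \<bar>h x\<bar>"])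
    show "AE x in \<rho>. (\<lambda>n. (g n x)\<^sup>2 * h x) \<longlonglongrightarrow> indicator K x * h x"
    proof (rule AE_I2)
      fix x
      have "(\<lambda>n. (g n x)\<^sup>2) \<longlonglongrightarrow> indicator K x"
      proof (cases "x \<in> K")
        case True
        then show ?thesis by (simp add: g_def)
      next
        case out: False
        then have pos_dist: "infdist x K > 0"
          using infdist_pos_not_in_closed[OF compact_imp_closed[OF K] False, of x] by simp
        obtain N where N: "1 / infdist x K < real N" using reals_Archimedean2 by blast
        have "g n x = 0" if "n \<ge> N" for n
        proof -
          have "1 / infdist x K < real n" using N that by linarith
          then show ?thesis using pos_dist by (simp add: g_def field_simps)
        qed
        then have "\<forall>\<^sub>F n in sequentially. (g n x)\<^sup>2 = 0"
          by (auto simp: eventually_sequentially)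
        then show ?thesis using out by (simp add: tendsto_eventually)
      qed
      then show "(\<lambda>n. (g n x)\<^sup>2 * h x) \<longlonglongrightarrow> indicator K x * h x"
        by (intro tendsto_intros)
    qed
    have "\<bar>g n x\<bar> \<le> 1" for n x
      using infdist_nonneg[of x K] by (simp add: g_def max_def)
    then have "(g n x)\<^sup>2 \<le> 1" for n x by (simp add: abs_square_le_1)
    then show "AE x in \<rho>. norm ((g n x)\<^sup>2 * h x) \<le> \<bar>h x\<bar>" for n
      by (simp add: abs_mult mult_left_le_one_le)
  qed (use h gm Km in simp_all)
  then show ?thesis
    by (rule LIMSEQ_le_const) (use integral_square_continuous_nonneg[OF h pos g] in auto)
qed simp

text \<open>If \<open>{x. h x < 0}\<close> had positive measure, inner regularity would give a
  compact subset of positive measure, over which the integral of \<open>h\<close> would be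
  negative.\<close>

lemma AE_nonneg_if_squares_nonneg:
  fixes h :: "real \<Rightarrow> real"
  assumes h: "integrable \<rho> h" and pos: "\<And>p. (\<integral>x. (poly p x)\<^sup>2 * h x \<partial>\<rho>) \<ge> 0"
  shows "AE x in \<rho>. h x \<ge> 0"
proof -
  have hm [measurable]: "h \<in> borel_measurable \<rho>" using h by simp
  define E where "E = {x. h x < 0}"
  have "{x \<in> space \<rho>. h x < 0} \<in> sets \<rho>" by measurable
  then have E: "E \<in> sets borel" by (simp add: E_def)
  have "emeasure \<rho> K = 0" if K: "K \<subseteq> E" "compact K" for K
  proof -
    have Km: "K \<in> sets borel" by (intro borel_closed compact_imp_closed K)
    have int: "integrable \<rho> (\<lambda>x. indicator K x * - h x)"
      using integrable_mult_indicator[of K \<rho> "\<lambda>x. - h x"] h Km by simp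
    have nonneg: "indicator K x * - h x \<ge> 0" for x
      using K by (auto simp: E_def indicator_def)
    have "(\<integral>x. indicator K x * - h x \<partial>\<rho>) \<le> 0"
      using set_integral_compact_nonneg[OF h pos K(2)] by simp
    moreover have "(\<integral>x. indicator K x * - h x \<partial>\<rho>) \<ge> 0"
      by (intro integral_nonneg_AE AE_I2 nonneg)
    ultimately have "AE x in \<rho>. indicator K x * - h x = 0"
      using integral_nonneg_eq_0_iff_AE[OF int] nonneg by auto
    then have "AE x in \<rho>. x \<notin> K"
      by eventually_elim (use K in \<open>auto simp: E_def indicator_def\<close>)
    then show ?thesis
      using AE_iff_null_sets[of K \<rho>] Km by (auto simp: null_sets_def)
  qed
  then have "(SUP K\<in>{K. K \<subseteq> E \<and> compact K}. emeasure \<rho> K) \<le> 0"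
    by (intro SUP_least) simp
  moreover have "emeasure \<rho> E = (SUP K\<in>{K. K \<subseteq> E \<and> compact K}. emeasure \<rho> K)"
    using E by (intro inner_regular) auto
  ultimately have "emeasure \<rho> E = 0" by simp
  then have "E \<in> null_sets \<rho>" using E by (simp add: null_sets_def)
  then have "AE x in \<rho>. x \<notin> E" by (rule AE_not_in)
  then show ?thesis by eventually_elim (auto simp: E_def)
qed

end

text \<open>The sum of the measures dominates each of them, so Radon-Nikodym applies. A single
  reference measure is what allows the entries of a matrix to be combined pointwise.\<close>

lemma common_density:
  fixes \<mu> :: "'t \<Rightarrow> real measure"
  assumes T: "finite T" and \<mu>: "\<And>t. t \<in> T \<Longrightarrow> compactly_supported_measure (\<mu> t)"
  shows "\<exists>\<rho> g. compactly_supported_measure \<rho> \<and>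
    (\<forall>t\<in>T. integrable \<rho> (g t) \<and> (\<forall>x. g t x \<ge> 0) \<and> \<mu> t = density \<rho> (\<lambda>x. ennreal (g t x)))"
proof -
  define \<rho> where "\<rho> = measure_of UNIV (sets borel) (\<lambda>E. \<Sum>t\<in>T. emeasure (\<mu> t) E)"
  have sets\<mu>: "sets (\<mu> t) = sets borel" if "t \<in> T" for t
    using \<mu>[OF that] by (simp add: compactly_supported_measure.sets_borel)
  have sets\<rho>: "sets \<rho> = sets borel"
    by (simp add: \<rho>_def sets.sigma_sets_eq[of borel, simplified])
  have space\<rho>: "space \<rho> = UNIV"
    using sets_eq_imp_space_eq[OF sets\<rho>] by simp
  have em\<rho>: "emeasure \<rho> E = (\<Sum>t\<in>T. emeasure (\<mu> t) E)" if "E \<in> sets borel" for E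
  proof (rule emeasure_measure_of[OF \<rho>_def])
    show "countably_additive (sets \<rho>) (\<lambda>E. \<Sum>t\<in>T. emeasure (\<mu> t) E)"
    proof (rule countably_additiveI)
      fix F :: "nat \<Rightarrow> real set"
      assume F: "range F \<subseteq> sets \<rho>" "disjoint_family F"
      have "(\<Sum>i. \<Sum>t\<in>T. emeasure (\<mu> t) (F i)) = (\<Sum>t\<in>T. \<Sum>i. emeasure (\<mu> t) (F i))"
        by (intro suminf_sum) auto
      also have "\<dots> = (\<Sum>t\<in>T. emeasure (\<mu> t) (\<Union>i. F i))"
        using F sets\<mu> by (intro sum.cong refl suminf_emeasure) (auto simp: sets\<rho>)
      finally show "(\<Sum>i. \<Sum>t\<in>T. emeasure (\<mu> t) (F i)) = (\<Sum>t\<in>T. emeasure (\<mu> t) (\<Union>i. F i))" .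
    qed
  qed (use that in \<open>auto simp: sets\<rho> positive_def\<close>)
  have fin: "emeasure (\<mu> t) UNIV \<noteq> \<infinity>" if "t \<in> T" for t
    using \<mu>[OF that] finite_measure.emeasure_finite[of "\<mu> t"]
    by (auto simp: compactly_supported_measure_def)
  have finite: "finite_measure \<rho>"
    using fin by (intro finite_measureI) (auto simp: space\<rho> em\<rho> T)
  have "{x::real. \<not> \<bar>x\<bar> \<le> 1} \<in> sets borel" by measurable
  moreover have "emeasure (\<mu> t) {x. \<not> \<bar>x\<bar> \<le> 1} = 0" if "t \<in> T" for t
  proof -
    interpret compactly_supported_measure "\<mu> t" using \<mu>[OF that] .
    show ?thesis using support AE_iff_measurable[OF _ refl, of "\<mu> t" "\<lambda>x. \<bar>x\<bar> \<le> 1"] by simp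
  qed
  ultimately have "emeasure \<rho> {x. \<not> \<bar>x\<bar> \<le> 1} = 0" by (simp add: em\<rho>)
  then have "AE x in \<rho>. \<bar>x\<bar> \<le> 1"
    using AE_iff_measurable[OF _ refl, of \<rho> "\<lambda>x. \<bar>x\<bar> \<le> 1"] by (simp add: sets\<rho> space\<rho>)
  with finite sets\<rho> have \<rho>: "compactly_supported_measure \<rho>"
    by (simp add: compactly_supported_measure_def compactly_supported_measure_axioms_def)
  interpret \<rho>: compactly_supported_measure \<rho> by (rule \<rho>)
  have "\<exists>g. integrable \<rho> g \<and> (\<forall>x. g x \<ge> 0) \<and> \<mu> t = density \<rho> (\<lambda>x. ennreal (g x))" if t: "t \<in> T" for t
  proof -
    interpret \<mu>: compactly_supported_measure "\<mu> t" using \<mu>[OF t] .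
    have ac: "absolutely_continuous \<rho> (\<mu> t)"
      using t T by (auto simp: absolutely_continuous_def null_sets_def sets\<rho> em\<rho>)
    obtain D where D: "D \<in> borel_measurable \<rho>" "AE x in \<rho>. RN_deriv \<rho> (\<mu> t) x = ennreal (D x)" "\<And>x. 0 \<le> D x"
      using \<rho>.real_RN_deriv[OF \<mu>.finite_measure_axioms ac] by auto
    have "\<mu> t = density \<rho> (RN_deriv \<rho> (\<mu> t))"
      using \<rho>.density_RN_deriv[OF ac] by simp
    also have "\<dots> = density \<rho> (\<lambda>x. ennreal (D x))"
      using D by (intro density_cong) auto
    finally have eq: "\<mu> t = density \<rho> (\<lambda>x. ennreal (D x))" .
    have "(\<integral>\<^sup>+x. ennreal (D x) \<partial>\<rho>) = emeasure (\<mu> t) UNIV"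
      unfolding eq using D(1) by (subst emeasure_density) auto
    also have "\<dots> < \<infinity>"
      using fin[OF t] unfolding infinity_ennreal_def less_top .
    finally have "integrable \<rho> D"
      using D by (intro integrableI_nonneg) auto
    with D eq show ?thesis by blast
  qed
  then obtain g where "\<And>t. t \<in> T \<Longrightarrow> integrable \<rho> (g t) \<and> (\<forall>x. g t x \<ge> 0) \<and> \<mu> t = density \<rho> (\<lambda>x. ennreal (g t x))"
    by metis
  with \<rho> show ?thesis by blast
qed

subsection \<open>The matrix moment problem\<close>

definition quadratic_form :: "('d \<Rightarrow> 'd \<Rightarrow> complex) \<Rightarrow> ('d \<Rightarrow> complex) \<Rightarrow> complex"
  where "quadratic_form H v = (\<Sum>p\<in>UNIV. \<Sum>q\<in>UNIV. cnj (v p) * H p q * v q)"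

lemma quadratic_form_real:
  assumes "\<And>p q. H q p = cnj (H p q)"
  shows "Im (quadratic_form H v) = 0"
proof -
  have "cnj (quadratic_form H v) = (\<Sum>p\<in>UNIV. \<Sum>q\<in>UNIV. cnj (v q) * H q p * v p)"
    by (simp add: quadratic_form_def mult_ac flip: assms)
  also have "\<dots> = quadratic_form H v"
    unfolding quadratic_form_def by (rule sum.swap)
  finally show ?thesis by (simp add: complex_eq_iff)
qed

lemma sum_rotate:
  "(\<Sum>a\<in>A. \<Sum>b\<in>B. \<Sum>c\<in>C. f a b c) = (\<Sum>c\<in>C. \<Sum>a\<in>A. \<Sum>b\<in>B. f a b c)"
proof -
  have "(\<Sum>b\<in>B. \<Sum>c\<in>C. f a b c) = (\<Sum>c\<in>C. \<Sum>b\<in>B. f a b c)" for a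
    by (rule sum.swap)
  then show ?thesis by (simp add: sum.swap[of _ C A])
qed

text \<open>The vector \<open>e_p + c e_q\<close>. As a sum it also covers \<open>p = q\<close>,
  where it is \<open>(1 + c) e_p\<close>, so polarization needs no case distinction.\<close>

definition two_point :: "complex \<Rightarrow> 'd \<Rightarrow> 'd \<Rightarrow> 'd \<Rightarrow> complex"
  where "two_point c p q r = (if r = p then 1 else 0) + (if r = q then c else 0)"

lemma quadratic_form_two_point:
  fixes H :: "'d::finite \<Rightarrow> 'd \<Rightarrow> complex"
  shows "quadratic_form H (two_point c p q) = H p p + cnj c * c * H q q + c * H p q + cnj c * H q p"
proof -
  have e: "(\<Sum>r\<in>UNIV. two_point c p q r * X r) = X p + c * X q" and
    e': "(\<Sum>r\<in>UNIV. cnj (two_point c p q r) * X r) = X p + cnj c * X q" for X :: "'d \<Rightarrow> complex"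
    by (simp_all add: two_point_def ring_distribs sum.distrib if_distrib[of "\<lambda>x. x * _"] if_distrib[of cnj] cong: if_cong)
  have "quadratic_form H (two_point c p q)
    = (\<Sum>r\<in>UNIV. cnj (two_point c p q r) * (\<Sum>s\<in>UNIV. two_point c p q s * H r s))"
    by (simp add: quadratic_form_def sum_distrib_left mult_ac)
  then show ?thesis unfolding e e' by (simp add: algebra_simps)
qed

text \<open>The term for \<open>c\<close> has coefficient \<open>cnj c\<close>. Over the fourth
  roots of unity both \<open>cnj c\<close> and its square sum to 0, which removes the diagonal terms
  and \<open>H q p\<close>, while \<open>cnj c * c = 1\<close> leaves four copies of
  \<open>H p q\<close>.\<close>

lemma quadratic_form_polarization:
  fixes H :: "'d::finite \<Rightarrow> 'd \<Rightarrow> complex"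
  shows "quadratic_form H (two_point 1 p q) - \<i> * quadratic_form H (two_point \<i> p q)
    - quadratic_form H (two_point (-1) p q) + \<i> * quadratic_form H (two_point (-\<i>) p q) = 4 * H p q"
  by (simp add: quadratic_form_two_point algebra_simps)

text \<open>\<open>factor\<close> presents the Hankel matrix truncated at \<open>N\<close> as a Gram
  matrix. The index set may depend on \<open>N\<close>, because the powers of a chain up to
  \<open>N\<close> reach only sites within distance \<open>N\<close>; each factorization is then a
  finite sum.\<close>

locale matrix_moments =
  fixes H :: "nat \<Rightarrow> 'd::finite \<Rightarrow> 'd \<Rightarrow> complex" and K :: "'d \<Rightarrow> 'd \<Rightarrow> real"
    and S :: "nat \<Rightarrow> 's set" and G :: "nat \<Rightarrow> nat \<Rightarrow> 's \<Rightarrow> 'd \<Rightarrow> complex"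
  assumes bound: "cmod (H k p q) \<le> K p q"
    and hermitian: "H k q p = cnj (H k p q)"
    and factor: "k \<le> N \<Longrightarrow> l \<le> N \<Longrightarrow> H (k + l) p q = (\<Sum>s\<in>S N. cnj (G N k s p) * G N l s q)"
begin

definition vector_moments :: "('d \<Rightarrow> complex) \<Rightarrow> nat \<Rightarrow> real"
  where "vector_moments v k = Re (quadratic_form (H k) v)"

lemma of_real_vector_moments: "of_real (vector_moments v k) = quadratic_form (H k) v"
  unfolding vector_moments_def using quadratic_form_real[of "H k" v, OF hermitian]
  by (simp add: complex_eq_iff)

text \<open>The Gram factorization turns the Hankel form into the sum over \<open>s\<close> of the
  squared moduli of \<open>z s\<close>, where \<open>z\<close> combines the Gram vectors of
  \<open>v\<close> with the coefficients of \<open>p\<close>.\<close>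

lemma vector_moments_square_nonneg: "moment_functional (vector_moments v) (p * p) \<ge> 0"
proof -
  define N where "N = degree p"
  define y where "y i s = (\<Sum>r\<in>UNIV. G N i s r * v r)" for i s
  define z where "z s = (\<Sum>i\<le>N. of_real (coeff p i) * y i s)" for s
  have qf: "quadratic_form (H (i + j)) v = (\<Sum>s\<in>S N. cnj (y i s) * y j s)" if "i \<le> N" "j \<le> N" for i j
  proof -
    have "quadratic_form (H (i + j)) v
      = (\<Sum>p\<in>UNIV. \<Sum>q\<in>UNIV. \<Sum>s\<in>S N. cnj (G N i s p * v p) * (G N j s q * v q))"
      by (simp add: quadratic_form_def factor[OF that] sum_distrib_left sum_distrib_right mult_ac)
    also have "\<dots> = (\<Sum>s\<in>S N. \<Sum>p\<in>UNIV. \<Sum>q\<in>UNIV. cnj (G N i s p * v p) * (G N j s q * v q))"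
      by (rule sum_rotate)
    finally show ?thesis
      by (simp add: y_def sum_product del: complex_cnj_mult)
  qed
  have "complex_of_real (moment_functional (vector_moments v) (p * p))
    = (\<Sum>i\<le>N. \<Sum>j\<le>N. of_real (coeff p i) * of_real (coeff p j) * (\<Sum>s\<in>S N. cnj (y i s) * y j s))"
    by (simp add: moment_functional_mult of_real_vector_moments qf flip: N_def)
  also have "\<dots> = (\<Sum>i\<le>N. \<Sum>j\<le>N. \<Sum>s\<in>S N. cnj (of_real (coeff p i) * y i s) * (of_real (coeff p j) * y j s))"
    by (simp add: sum_distrib_left mult_ac)
  also have "\<dots> = (\<Sum>s\<in>S N. \<Sum>i\<le>N. \<Sum>j\<le>N. cnj (of_real (coeff p i) * y i s) * (of_real (coeff p j) * y j s))"
    by (rule sum_rotate)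
  also have "\<dots> = (\<Sum>s\<in>S N. cnj (z s) * z s)"
    by (simp add: z_def sum_product del: complex_cnj_mult)
  also have "\<dots> = of_real (\<Sum>s\<in>S N. (cmod (z s))\<^sup>2)"
    unfolding of_real_sum complex_norm_square by (simp add: mult.commute)
  finally have "moment_functional (vector_moments v) (p * p) = (\<Sum>s\<in>S N. (cmod (z s))\<^sup>2)"
    using of_real_eq_iff by blast
  then show ?thesis by (simp add: sum_nonneg)
qed

lemma vector_moments_bounded: "\<exists>B. \<forall>k. \<bar>vector_moments v k\<bar> \<le> B"
proof (intro exI allI)
  fix k
  have "\<bar>vector_moments v k\<bar> \<le> cmod (quadratic_form (H k) v)"
    unfolding vector_moments_def by (rule abs_Re_le_cmod)
  also have "\<dots> \<le> (\<Sum>p\<in>UNIV. \<Sum>q\<in>UNIV. cmod (v p) * K p q * cmod (v q))"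
    unfolding quadratic_form_def
    by (intro sum_norm_le order_trans[OF norm_sum] sum_mono) (auto simp: norm_mult intro!: mult_right_mono mult_left_mono bound)
  finally show "\<bar>vector_moments v k\<bar> \<le> (\<Sum>p\<in>UNIV. \<Sum>q\<in>UNIV. cmod (v p) * K p q * cmod (v q))" .
qed

lemma vector_moments_measure:
  "\<exists>M. compactly_supported_measure M \<and> (\<forall>k. (\<integral>x. x ^ k \<partial>M) = vector_moments v k)"
proof -
  obtain B where "\<And>k. \<bar>vector_moments v k\<bar> \<le> B" using vector_moments_bounded by blast
  then interpret bounded_moments "vector_moments v" B
    by unfold_locales (auto intro: vector_moments_square_nonneg)
  show ?thesis
    using exists_representing_measure
    by (auto simp: compactly_supported_measure_def compactly_supported_measure_axioms_def)
qed

theorem exists_matrix_density: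
  "\<exists>\<rho> w. compactly_supported_measure \<rho> \<and> (\<forall>p q. integrable \<rho> (w p q)) \<and>
    (\<forall>p q k. (\<integral>x. of_real (x ^ k) * w p q x \<partial>\<rho>) = H k p q) \<and>
    (\<forall>p q x. w q p x = cnj (w p q x)) \<and>
    (\<forall>v. AE x in \<rho>. Re (quadratic_form (\<lambda>p q. w p q x) v) \<ge> 0)"
proof -
  define T :: "(complex \<times> 'd \<times> 'd) set" where "T = {1, \<i>, -1, -\<i>} \<times> UNIV"
  obtain M where M: "\<And>v. compactly_supported_measure (M v)"
    and M_moments: "\<And>v k. (\<integral>x. x ^ k \<partial>M v) = vector_moments v k"
    using vector_moments_measure by metis
  have "\<exists>\<rho> g. compactly_supported_measure \<rho> \<and> (\<forall>t\<in>T. integrable \<rho> (g t) \<and> (\<forall>x. g t x \<ge> 0) \<and>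
      (case t of (c, p, q) \<Rightarrow> M (two_point c p q)) = density \<rho> (\<lambda>x. ennreal (g t x)))"
    by (rule common_density) (auto simp: T_def M split: prod.split)
  then obtain \<rho> g where \<rho>: "compactly_supported_measure \<rho>"
    and "\<forall>t\<in>T. integrable \<rho> (g t) \<and> (\<forall>x. g t x \<ge> 0) \<and>
      (case t of (c, p, q) \<Rightarrow> M (two_point c p q)) = density \<rho> (\<lambda>x. ennreal (g t x))"
    by (elim exE conjE)
  note g = bspec[OF this(2)]
  interpret \<rho>: compactly_supported_measure \<rho> by (rule \<rho>)
  have pow_cont: "continuous_on UNIV (\<lambda>x::real. complex_of_real (x ^ k))" for k
    by (intro continuous_intros)
  have g_int: "integrable \<rho> (g (c, p, q))" if "c \<in> {1, \<i>, -1, -\<i>}" for c p q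
    using g[of "(c, p, q)"] that by (simp add: T_def)
  have g_moment: "(\<integral>x. of_real (x ^ k) * complex_of_real (g (c, p, q) x) \<partial>\<rho>) = quadratic_form (H k) (two_point c p q)"
    if "c \<in> {1, \<i>, -1, -\<i>}" for c p q k
  proof -
    have t: "(c, p, q) \<in> T" using that by (simp add: T_def)
    have "vector_moments (two_point c p q) k = (\<integral>x. x ^ k \<partial>density \<rho> (\<lambda>x. ennreal (g (c, p, q) x)))"
    proof -
      have "M (two_point c p q) = density \<rho> (\<lambda>x. ennreal (g (c, p, q) x))" using g[OF t] by simp
      then show ?thesis using M_moments[of "two_point c p q" k] by simp
    qed
    also have "\<dots> = (\<integral>x. x ^ k * g (c, p, q) x \<partial>\<rho>)"
      using g[OF t] by (subst integral_density) (auto simp: mult.commute)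
    finally show ?thesis
      by (simp flip: of_real_mult of_real_power add: of_real_vector_moments[symmetric])
  qed
  have gc_int: "integrable \<rho> (\<lambda>x. complex_of_real (g (c, p, q) x))"
      "integrable \<rho> (\<lambda>x. of_real (x ^ k) * complex_of_real (g (c, p, q) x))"
    if "c \<in> {1, \<i>, -1, -\<i>}" for c p q k
    using g_int[OF that, THEN integrable_of_real] \<rho>.integrable_continuous_mult[OF pow_cont] by auto
  \<comment> \<open>Polarization at the level of densities: the moments of \<open>u p q\<close> are
    then the polarized quadratic forms of \<open>H k\<close>.\<close>
  define u where "u p q x = (of_real (g (1, p, q) x) - \<i> * of_real (g (\<i>, p, q) x)
    - of_real (g (-1, p, q) x) + \<i> * of_real (g (-\<i>, p, q) x)) / 4" for p q x
  have u_int: "integrable \<rho> (u p q)" for p q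
    unfolding u_def by (intro integrable_divide integrable_mult_right Bochner_Integration.integrable_add
        Bochner_Integration.integrable_diff gc_int) auto
  have u_moment: "(\<integral>x. of_real (x ^ k) * u p q x \<partial>\<rho>) = H k p q" for p q k
  proof -
    define F where "F c x = of_real (x ^ k) * complex_of_real (g (c, p, q) x)" for c x
    have F: "integrable \<rho> (F c)" "(\<integral>x. F c x \<partial>\<rho>) = quadratic_form (H k) (two_point c p q)"
      if "c \<in> {1, \<i>, -1, -\<i>}" for c
      unfolding F_def by (rule gc_int(2)[OF that], rule g_moment[OF that])
    have eq: "of_real (x ^ k) * u p q x = (F 1 x - \<i> * F \<i> x - F (-1) x + \<i> * F (-\<i>) x) / 4" for x
      by (simp add: u_def F_def field_simps)
    have "(\<integral>x. of_real (x ^ k) * u p q x \<partial>\<rho>) = (quadratic_form (H k) (two_point 1 p q) - \<i> * quadratic_form (H k) (two_point \<i> p q)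
      - quadratic_form (H k) (two_point (-1) p q) + \<i> * quadratic_form (H k) (two_point (-\<i>) p q)) / 4"
      unfolding eq using F by simp
    also have "\<dots> = H k p q"
      unfolding quadratic_form_polarization by simp
    finally show ?thesis .
  qed
  \<comment> \<open>The averaging makes the density Hermitian at every point, not just almost everywhere.\<close>
  define w where "w p q x = (u p q x + cnj (u q p x)) / 2" for p q x
  have w_int: "integrable \<rho> (w p q)" for p q
    unfolding w_def using u_int by auto
  have xw_int: "integrable \<rho> (\<lambda>x. of_real (x ^ k) * w p q x)" for p q k
    by (rule \<rho>.integrable_continuous_mult[OF pow_cont w_int])
  have w_moment: "(\<integral>x. of_real (x ^ k) * w p q x \<partial>\<rho>) = H k p q" for p q k
  proof -
    define F where "F p q x = of_real (x ^ k) * u p q x" for p q x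
    have F: "integrable \<rho> (F p q)" "(\<integral>x. F p q x \<partial>\<rho>) = H k p q" for p q
      unfolding F_def by (rule \<rho>.integrable_continuous_mult[OF pow_cont u_int], rule u_moment)
    have eq: "of_real (x ^ k) * w p q x = (F p q x + cnj (F q p x)) / 2" for x
      by (simp add: w_def F_def field_simps)
    \<comment> \<open>Averaging with the conjugate transpose preserves the moments because
      \<open>H k\<close> is Hermitian.\<close>
    have "integrable \<rho> (\<lambda>x. cnj (F q p x))" "(\<integral>x. cnj (F q p x) \<partial>\<rho>) = H k p q"
      using F[of q p] Bochner_Integration.integral_cnj[of \<rho> "F q p"] by (simp_all add: hermitian[of k p q])
    then show ?thesis
      unfolding eq using F[of p q] by simp
  qed
  have w_herm: "w q p x = cnj (w p q x)" for p q x
    by (simp add: w_def add.commute)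
  \<comment> \<open>For a general \<open>v\<close> this form is not claimed to be a density of
    \<open>M v\<close>. Its moments are \<open>vector_moments v\<close>, however, so its integrals
    against squares of polynomials are nonnegative.\<close>
  have "AE x in \<rho>. Re (quadratic_form (\<lambda>p q. w p q x) v) \<ge> 0" for v
  proof (rule \<rho>.AE_nonneg_if_squares_nonneg)
    let ?h = "\<lambda>x. Re (quadratic_form (\<lambda>p q. w p q x) v)"
    have qf_int: "integrable \<rho> (\<lambda>x. quadratic_form (\<lambda>p q. w p q x) v)"
      unfolding quadratic_form_def
      by (intro Bochner_Integration.integrable_sum integrable_mult_left integrable_mult_right w_int)
    then show h_int: "integrable \<rho> ?h" by (rule integrable_Re)
    have moment: "(\<integral>x. x ^ k * ?h x \<partial>\<rho>) = vector_moments v k" for k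
    proof -
      have eq: "of_real (x ^ k) * quadratic_form (\<lambda>p q. w p q x) v
          = (\<Sum>p\<in>UNIV. \<Sum>q\<in>UNIV. cnj (v p) * (of_real (x ^ k) * w p q x) * v q)" for x
        by (simp add: quadratic_form_def sum_distrib_left mult_ac)
      have "(\<integral>x. of_real (x ^ k) * quadratic_form (\<lambda>p q. w p q x) v \<partial>\<rho>)
          = (\<Sum>p\<in>UNIV. \<Sum>q\<in>UNIV. cnj (v p) * (\<integral>x. of_real (x ^ k) * w p q x \<partial>\<rho>) * v q)"
        unfolding eq using xw_int by simp
      also have "\<dots> = quadratic_form (H k) v"
        by (simp only: w_moment quadratic_form_def)
      finally have "Re (\<integral>x. of_real (x ^ k) * quadratic_form (\<lambda>p q. w p q x) v \<partial>\<rho>) = vector_moments v k"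
        by (simp only: vector_moments_def)
      moreover have "Re (\<integral>x. of_real (x ^ k) * quadratic_form (\<lambda>p q. w p q x) v \<partial>\<rho>)
          = (\<integral>x. Re (of_real (x ^ k) * quadratic_form (\<lambda>p q. w p q x) v) \<partial>\<rho>)"
        by (rule integral_Re[symmetric]) (rule \<rho>.integrable_continuous_mult[OF pow_cont qf_int])
      ultimately show ?thesis by (simp flip: of_real_power)
    qed
    show "(\<integral>x. (poly p x)\<^sup>2 * ?h x \<partial>\<rho>) \<ge> 0" for p
    proof -
      have "(\<integral>x. poly (p * p) x * ?h x \<partial>\<rho>) = moment_functional (vector_moments v) (p * p)"
        by (intro moment_functional_integral moment \<rho>.integrable_continuous_mult[OF _ h_int] continuous_intros)
      then show ?thesis
        using vector_moments_square_nonneg[of v p] by (simp add: power2_eq_square)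
    qed
  qed
  with \<rho> w_int w_moment w_herm show ?thesis
    by (intro exI[of _ \<rho>] exI[of _ w] conjI allI)
qed

end

text \<open>For fixed \<open>S\<close> and \<open>v\<close> the form of the integrated matrix is the
  integral over \<open>S\<close> of the pointwise form. Only one \<open>v\<close> occurs at a time,
  so the exceptional null set may vary with \<open>v\<close>.\<close>

lemma (in compactly_supported_measure) weight_matrix_density:
  fixes w :: "'d::finite \<Rightarrow> 'd \<Rightarrow> real \<Rightarrow> complex"
  assumes int: "\<And>p q. integrable \<rho> (w p q)" and herm: "\<And>p q x. w q p x = cnj (w p q x)"
    and pos: "\<And>v. AE x in \<rho>. Re (quadratic_form (\<lambda>p q. w p q x) v) \<ge> 0"
  shows "weight_matrix (\<lambda>S. \<chi> p q. LINT x:S|\<rho>. w p q x)"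
proof -
  have "psd (\<chi> p q. LINT x:S|\<rho>. w p q x)" if S: "S \<in> sets borel" for S
  proof -
    have set_int: "integrable \<rho> (\<lambda>x. indicator S x *\<^sub>R w p q x)" for p q
      using S int by (intro integrable_mult_indicator) auto
    have sym: "(LINT x:S|\<rho>. w q p x) = cnj (LINT x:S|\<rho>. w p q x)" for p q
      unfolding set_lebesgue_integral_def using set_int
      using Bochner_Integration.integral_cnj[of \<rho> "\<lambda>x. indicator S x *\<^sub>R w p q x"]
      by (simp add: herm[of q p] scaleR_conv_of_real)
    have "Re (quadratic_form (\<lambda>p q. LINT x:S|\<rho>. w p q x) v) \<ge> 0" for v
    proof -
      define f where "f p q x = indicator S x *\<^sub>R w p q x" for p q x
      have eq: "indicator S x *\<^sub>R quadratic_form (\<lambda>p q. w p q x) v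
        = (\<Sum>p\<in>UNIV. \<Sum>q\<in>UNIV. cnj (v p) * f p q x * v q)" for x
        by (simp add: quadratic_form_def scaleR_sum_right f_def)
      have f_int: "integrable \<rho> (f p q)" for p q
        unfolding f_def by (rule set_int)
      have int': "integrable \<rho> (\<lambda>x. indicator S x *\<^sub>R quadratic_form (\<lambda>p q. w p q x) v)"
        unfolding eq by (intro Bochner_Integration.integrable_sum integrable_mult_left integrable_mult_right f_int)
      have "quadratic_form (\<lambda>p q. LINT x:S|\<rho>. w p q x) v
        = (\<integral>x. indicator S x *\<^sub>R quadratic_form (\<lambda>p q. w p q x) v \<partial>\<rho>)"
        unfolding eq unfolding quadratic_form_def set_lebesgue_integral_def f_def[symmetric] using f_int by simp
      then have "Re (quadratic_form (\<lambda>p q. LINT x:S|\<rho>. w p q x) v)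
        = (\<integral>x. Re (indicator S x *\<^sub>R quadratic_form (\<lambda>p q. w p q x) v) \<partial>\<rho>)"
        using int' by (simp only: integral_Re)
      also have "\<dots> \<ge> 0"
        using pos[of v] by (intro integral_nonneg_AE) (auto elim!: eventually_mono)
      finally show ?thesis .
    qed
    moreover have "Im (quadratic_form (\<lambda>p q. LINT x:S|\<rho>. w p q x) v) = 0" for v
      by (rule quadratic_form_real) (rule sym)
    ultimately have "quadratic_form (\<lambda>p q. LINT x:S|\<rho>. w p q x) v \<in> \<real>\<^sub>\<ge>\<^sub>0" for v
      by (simp add: complex_nonneg_Reals_iff)
    then show ?thesis
      by (auto simp: psd_def hermitian_def cadj_def vec_eq_iff quadratic_form_def sym[symmetric])
  qed
  then show ?thesis
    by (simp add: weight_matrix_def complex_measure_density finite_moments_density int)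
qed

subsection \<open>Conjugate transposes and matrix products\<close>

lemma cadj_nth: "cadj M $ i $ j = cnj (M $ j $ i)"
  by (simp add: cadj_def)

lemma cadj_cadj [simp]: "cadj (cadj M) = M"
  by (simp add: cadj_def vec_eq_iff)

lemma cadj_0 [simp]: "cadj 0 = 0"
  by (simp add: cadj_def vec_eq_iff)

lemma cadj_mat_1 [simp]: "cadj (mat 1) = mat 1"
  by (simp add: cadj_def mat_def vec_eq_iff)

lemma cadj_add: "cadj (M + N) = cadj M + cadj N"
  by (simp add: cadj_def vec_eq_iff)

lemma cadj_mult: "cadj (M ** N) = cadj N ** cadj M"
  by (simp add: cadj_def matrix_matrix_mult_def vec_eq_iff mult.commute)

lemma matrix_add_rdistrib: "(A + B) ** C = A ** C + (B ** C :: 'a::semiring_1 ^ 'p ^ 'm)"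
  by (simp add: matrix_matrix_mult_def vec_eq_iff sum.distrib ring_distribs)

lemma matrix_mult_sum_right: "(A :: 'a::semiring_1 ^ 'n ^ 'm) ** (\<Sum>i\<in>S. f i) = (\<Sum>i\<in>S. A ** f i)"
  by (induction S rule: infinite_finite_induct) (auto simp: matrix_add_ldistrib)

lemma matrix_inv_mult_cancel:
  fixes M :: "complex ^ 'm ^ 'm"
  assumes "invertible M"
  shows "matrix_inv M ** (M ** N) = N"
  using someI_ex[OF assms[unfolded invertible_def]]
  by (simp add: matrix_inv_def matrix_mul_assoc)

lemma invertible_cadj: "invertible (cadj M)" if "invertible M"
proof -
  from that obtain N where "M ** N = mat 1" "N ** M = mat 1"
    by (auto simp: invertible_def)
  then have "cadj N ** cadj M = mat 1" "cadj M ** cadj N = mat 1"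
    by (simp_all flip: cadj_mult)
  then show ?thesis by (auto simp: invertible_def)
qed

subsection \<open>Block tridiagonal chains\<close>

lemma block_tridiagonal_nth:
  assumes "block_tridiagonal \<Phi> A B C"
  shows "\<Phi> j (j - 1) = A (j - 1)" and "\<Phi> j j = B j" and "\<Phi> j (j + 1) = C (j + 1)"
    and "k \<notin> {j - 1, j, j + 1} \<Longrightarrow> \<Phi> j k = 0"
proof -
  have *: "\<And>k. \<Phi> (k + 1) k = A k" "\<And>k. \<Phi> k k = B k" "\<And>k. \<Phi> (k - 1) k = C k"
      "\<And>i j. \<bar>i - j\<bar> > 1 \<Longrightarrow> \<Phi> i j = 0"
    using assms by (auto simp: block_tridiagonal_def)
  show "\<Phi> j (j - 1) = A (j - 1)" "\<Phi> j j = B j" "\<Phi> j (j + 1) = C (j + 1)"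
    using *(1)[of "j - 1"] *(2)[of j] *(3)[of "j + 1"] by simp_all
  show "\<Phi> j k = 0" if "k \<notin> {j - 1, j, j + 1}"
    using that by (intro *(4)) auto
qed

lemma infsum_finite_support:
  assumes "finite S" and "\<And>x. x \<notin> S \<Longrightarrow> f x = 0"
  shows "infsum f UNIV = sum f S"
  using infsum_cong_neutral[of UNIV S f f] assms by simp

locale block_tridiagonal_chain =
  fixes \<Phi> :: "int \<Rightarrow> int \<Rightarrow> complex ^ 'm::finite ^ 'm" and A B C :: "int \<Rightarrow> complex ^ 'm ^ 'm"
  assumes tridiagonal: "block_tridiagonal \<Phi> A B C"
begin

abbreviation "P \<equiv> block_power \<Phi>"

lemma P_Suc_left:
  "P (Suc n) j i = A (j - 1) ** P n (j - 1) i + B j ** P n j i + C (j + 1) ** P n (j + 1) i"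
proof -
  have "P (Suc n) j i = (\<Sum>k\<in>{j - 1, j, j + 1}. \<Phi> j k ** P n k i)"
    unfolding block_power.simps
    by (rule infsum_finite_support) (use block_tridiagonal_nth(4)[OF tridiagonal] in auto)
  then show ?thesis
    by (simp add: block_tridiagonal_nth(1-3)[OF tridiagonal] add.assoc)
qed

text \<open>\<open>block_power\<close> multiplies from the left and thus moves the row index; a
  recurrence in the column index needs the last factor on the right. The induction interchanges the
  two three-term sums.\<close>

lemma P_Suc_right:
  "P (Suc n) j i = P n j (i + 1) ** A i + P n j i ** B i + P n j (i - 1) ** C i"
proof (induction n arbitrary: j)
  case 0
  have "A (j - 1) ** P 0 (j - 1) i = P 0 j (i + 1) ** A i" "B j ** P 0 j i = P 0 j i ** B i"
    "C (j + 1) ** P 0 (j + 1) i = P 0 j (i - 1) ** C i"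
    by auto
  then show ?case by (simp only: P_Suc_left)
next
  case (Suc n)
  have "P (Suc (Suc n)) j i = A (j - 1) ** P (Suc n) (j - 1) i + B j ** P (Suc n) j i + C (j + 1) ** P (Suc n) (j + 1) i"
    by (rule P_Suc_left)
  also have "\<dots> = A (j - 1) ** (P n (j - 1) (i + 1) ** A i + P n (j - 1) i ** B i + P n (j - 1) (i - 1) ** C i)
      + B j ** (P n j (i + 1) ** A i + P n j i ** B i + P n j (i - 1) ** C i)
      + C (j + 1) ** (P n (j + 1) (i + 1) ** A i + P n (j + 1) i ** B i + P n (j + 1) (i - 1) ** C i)"
    by (simp only: Suc.IH)
  also have "\<dots> = (A (j - 1) ** P n (j - 1) (i + 1) + B j ** P n j (i + 1) + C (j + 1) ** P n (j + 1) (i + 1)) ** A i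
      + (A (j - 1) ** P n (j - 1) i + B j ** P n j i + C (j + 1) ** P n (j + 1) i) ** B i
      + (A (j - 1) ** P n (j - 1) (i - 1) + B j ** P n j (i - 1) + C (j + 1) ** P n (j + 1) (i - 1)) ** C i"
    by (simp add: matrix_add_ldistrib matrix_add_rdistrib matrix_mul_assoc add_ac)
  finally show ?case by (simp only: P_Suc_left[of n])
qed

text \<open>In \<open>k\<close> steps the chain moves by at most \<open>k\<close> sites, so a finite
  window replaces the infinite sum. Asking only for inclusion in \<open>S\<close> lets the induction
  use the same \<open>S\<close> for \<open>j - 1\<close>, \<open>j\<close> and
  \<open>j + 1\<close>.\<close>

lemma P_add:
  assumes "finite S" and "{j - int k..j + int k} \<subseteq> S"
  shows "P (k + l) j i = (\<Sum>r\<in>S. P k j r ** P l r i)"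
  using assms(2)
proof (induction k arbitrary: j)
  case 0
  then have "j \<in> S" by auto
  have "(\<Sum>r\<in>S. P 0 j r ** P l r i) = (\<Sum>r\<in>S. if r = j then P l r i else 0)"
    by (intro sum.cong) auto
  with assms(1) \<open>j \<in> S\<close> show ?case by simp
next
  case (Suc k)
  have sub: "{j - 1 - int k..j - 1 + int k} \<subseteq> S" "{j - int k..j + int k} \<subseteq> S" "{j + 1 - int k..j + 1 + int k} \<subseteq> S"
    using Suc.prems by auto
  have "P (Suc k + l) j i = (\<Sum>r\<in>S. (A (j - 1) ** P k (j - 1) r) ** P l r i)
      + (\<Sum>r\<in>S. (B j ** P k j r) ** P l r i) + (\<Sum>r\<in>S. (C (j + 1) ** P k (j + 1) r) ** P l r i)"
    by (simp add: P_Suc_left Suc.IH[OF sub(1)] Suc.IH[OF sub(2)] Suc.IH[OF sub(3)]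
        matrix_mult_sum_right matrix_mul_assoc del: block_power.simps)
  then show ?case
    by (simp add: P_Suc_left matrix_add_rdistrib sum.distrib del: block_power.simps)
qed

end

text \<open>Matrix form of detailed balance: the block matrix with blocks
  \<open>cadj (R j) ** R j ** \<Phi> j i\<close> is Hermitian.\<close>

locale symmetrizable_chain = block_tridiagonal_chain \<Phi> A B C
  for \<Phi> :: "int \<Rightarrow> int \<Rightarrow> complex ^ 'm::finite ^ 'm" and A B C +
  fixes R :: "int \<Rightarrow> complex ^ 'm ^ 'm"
  assumes sym_AC: "cadj (A k) ** (cadj (R (k + 1)) ** R (k + 1)) = (cadj (R k) ** R k) ** C (k + 1)"
    and sym_B: "cadj (B k) ** (cadj (R k) ** R k) = (cadj (R k) ** R k) ** B k"
begin

definition weight :: "int \<Rightarrow> complex ^ 'm ^ 'm"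
  where "weight k = cadj (R k) ** R k"

lemma cadj_weight: "cadj (weight k) = weight k"
  by (simp add: weight_def cadj_mult)

lemma weight_C: "weight k ** C (k + 1) = cadj (A k) ** weight (k + 1)"
  using sym_AC[of k] by (simp add: weight_def)

lemma weight_B: "weight k ** B k = cadj (B k) ** weight k"
  using sym_B[of k] by (simp add: weight_def)

lemma weight_A: "weight (k + 1) ** A k = cadj (C (k + 1)) ** weight k"
  using arg_cong[OF weight_C[of k], of cadj] by (simp add: cadj_mult cadj_weight)

definition moment :: "nat \<Rightarrow> int \<Rightarrow> int \<Rightarrow> complex ^ 'm ^ 'm"
  where "moment n j i = weight j ** P n j i"

lemma moment_Suc_right:
  "moment (Suc n) j i = moment n j (i + 1) ** A i + moment n j i ** B i + moment n j (i - 1) ** C i"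
  by (simp add: moment_def P_Suc_right matrix_add_ldistrib matrix_mul_assoc del: block_power.simps)

text \<open>Carrying the weight across a step replaces \<open>A\<close>, \<open>B\<close>,
  \<open>C\<close> by the adjoints of \<open>C\<close>, \<open>B\<close>, \<open>A\<close>. The
  recurrence in \<open>j\<close> is therefore the adjoint of the one in \<open>i\<close>, and the
  symmetry of the moments follows by induction.\<close>

lemma moment_Suc_left:
  "moment (Suc n) j i = cadj (C j) ** moment n (j - 1) i + cadj (B j) ** moment n j i + cadj (A j) ** moment n (j + 1) i"
  using weight_A[of "j - 1"] weight_B[of j] weight_C[of j]
  by (simp add: moment_def P_Suc_left matrix_add_ldistrib matrix_mul_assoc del: block_power.simps)

lemma cadj_moment: "cadj (moment n j i) = moment n i j"
proof (induction n arbitrary: i j)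
  case 0
  then show ?case by (simp add: moment_def cadj_weight)
next
  case (Suc n)
  show ?case
    by (subst moment_Suc_left, subst moment_Suc_right) (simp add: cadj_add cadj_mult Suc.IH add_ac)
qed

text \<open>Since \<open>weight j ** P k j r\<close> is the adjoint of \<open>weight r ** P k r j\<close>, the moments
  are Gram matrices of the columns of the powers.\<close>

lemma moment_add:
  assumes "finite S" and "{j - int k..j + int k} \<subseteq> S"
  shows "moment (k + l) j i = (\<Sum>r\<in>S. cadj (R r ** P k r j) ** (R r ** P l r i))"
proof -
  have "moment (k + l) j i = (\<Sum>r\<in>S. moment k j r ** P l r i)"
    by (simp add: moment_def P_add[OF assms] matrix_mult_sum_right matrix_mul_assoc)
  also have "\<dots> = (\<Sum>r\<in>S. cadj (R r ** P k r j) ** (R r ** P l r i))"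
    by (intro sum.cong refl, subst cadj_moment[symmetric])
       (simp add: moment_def weight_def cadj_mult matrix_mul_assoc)
  finally show ?thesis .
qed

end

subsection \<open>Powers of a quantum Markov chain are bounded\<close>

lemma psd_iff_quadratic_form:
  "psd X \<longleftrightarrow> cadj X = X \<and> (\<forall>v. quadratic_form (\<lambda>p q. X $ p $ q) v \<in> \<real>\<^sub>\<ge>\<^sub>0)"
proof -
  have "(\<forall>v. quadratic_form (\<lambda>p q. X $ p $ q) v \<in> \<real>\<^sub>\<ge>\<^sub>0)
    \<longleftrightarrow> (\<forall>v. quadratic_form (\<lambda>p q. X $ p $ q) (\<lambda>i. v $ i) \<in> \<real>\<^sub>\<ge>\<^sub>0)"
    by (metis vec_lambda_inverse[OF UNIV_I])
  then show ?thesis by (simp add: psd_def hermitian_def quadratic_form_def)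
qed

text \<open>One-by-one block matrices, through which complete positivity yields positivity.\<close>

lemma block_psd_const: "block_psd (Suc 0) (\<lambda>_ _. X) \<longleftrightarrow> psd X"
proof -
  have "(\<forall>v :: nat \<Rightarrow> complex ^ 'a. Q (v 0)) \<longleftrightarrow> (\<forall>v. Q v)" for Q
  proof (intro iffI allI)
    fix v assume "\<forall>v :: nat \<Rightarrow> complex ^ 'a. Q (v 0)"
    from this[rule_format, of "\<lambda>_. v"] show "Q v" by simp
  qed simp
  from this[of "\<lambda>v. (\<Sum>i\<in>UNIV. \<Sum>j\<in>UNIV. cnj (v $ i) * X $ i $ j * v $ j) \<in> \<real>\<^sub>\<ge>\<^sub>0"]
  show ?thesis
    by (simp add: block_psd_def psd_def hermitian_def)
qed

lemma completely_positive_psd: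
  assumes "completely_positive F" and "psd X"
  shows "psd (F X)"
proof -
  have "block_psd (Suc 0) (\<lambda>_ _. X) \<longrightarrow> block_psd (Suc 0) (\<lambda>_ _. F X)"
    using assms(1) unfolding completely_positive_def by blast
  with assms(2) show ?thesis by (simp add: block_psd_const)
qed

lemma psd_add:
  assumes "psd X" "psd Y"
  shows "psd (X + Y)"
proof -
  have "quadratic_form (\<lambda>p q. (X + Y) $ p $ q) v
    = quadratic_form (\<lambda>p q. X $ p $ q) v + quadratic_form (\<lambda>p q. Y $ p $ q) v" for v
    by (simp add: quadratic_form_def ring_distribs sum.distrib)
  with assms show ?thesis
    by (auto simp: psd_iff_quadratic_form cadj_add complex_nonneg_Reals_iff)
qed

text \<open>The vectors \<open>e_p + c e_q\<close> with \<open>c = 1, -1\<close> bound twice the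
  real part of the entry by the sum of the two diagonal entries, and \<open>c = \<i>, -\<i>\<close>
  do so for the imaginary part. Each diagonal entry is at most the trace, whence the factor
  2.\<close>

lemma psd_entry_le_trace:
  assumes "psd X"
  shows "cmod (X $ p $ q) \<le> 2 * Re (trace X)"
proof -
  have sym: "X $ q $ p = cnj (X $ p $ q)" for p q
    using assms unfolding psd_iff_quadratic_form by (metis cadj_nth)
  have form: "0 \<le> Re (X $ p $ p + cnj c * c * X $ q $ q + c * X $ p $ q + cnj c * cnj (X $ p $ q))" for p q c
  proof -
    have "0 \<le> Re (quadratic_form (\<lambda>p q. X $ p $ q) (two_point c p q))"
      using assms unfolding psd_iff_quadratic_form by (simp add: complex_nonneg_Reals_iff)
    then show ?thesis unfolding quadratic_form_two_point by (simp only: sym[where p = p and q = q])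
  qed
  have diag: "Re (X $ p $ p) \<ge> 0" for p
    using form[of p 0] by simp
  have "Re (X $ p $ p) \<le> Re (trace X)" for p
    unfolding trace_def Re_sum using diag by (intro member_le_sum) auto
  from this[of p] this[of q] have "Re (X $ p $ p) + Re (X $ q $ q) \<le> 2 * Re (trace X)" by simp
  moreover have "\<bar>Re (X $ p $ q)\<bar> + \<bar>Im (X $ p $ q)\<bar> \<le> Re (X $ p $ p) + Re (X $ q $ q)"
    using form[of p 1 q] form[of p "-1" q] form[of p \<i> q] form[of p "-\<i>" q] by auto
  ultimately show ?thesis
    using cmod_le[of "X $ p $ q"] by linarith
qed

lemma superop_nth: "superop M X $ p $ q = (\<Sum>b\<in>UNIV. M $ (p, q) $ b * X $ fst b $ snd b)"
  by (simp add: superop_def unvec_rows_def vec_rows_def matrix_vector_mult_def)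

lemma superop_add: "superop (M + N) X = superop M X + superop N X"
  by (simp add: vec_eq_iff superop_nth ring_distribs sum.distrib)

lemma superop_mult: "superop (M ** N) X = superop M (superop N X)"
  by (simp add: superop_def matrix_vector_mul_assoc)

lemma superop_1 [simp]: "superop (mat 1) X = X"
  by (simp add: superop_def)

lemma superop_0 [simp]: "superop 0 X = 0"
  by (simp add: vec_eq_iff superop_nth)

lemma psd_0: "psd 0"
  by (simp add: psd_iff_quadratic_form quadratic_form_def complex_nonneg_Reals_iff)

definition rank_one :: "('n \<Rightarrow> complex) \<Rightarrow> complex ^ 'n ^ 'n"
  where "rank_one v = (\<chi> i j. v i * cnj (v j))"

lemma psd_rank_one: "psd (rank_one v)"
proof -
  have "quadratic_form (\<lambda>p q. rank_one v $ p $ q) u \<in> \<real>\<^sub>\<ge>\<^sub>0" for u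
  proof -
    define z where "z = (\<Sum>p\<in>UNIV. cnj (v p) * u p)"
    have "quadratic_form (\<lambda>p q. rank_one v $ p $ q) u = z * cnj z"
      unfolding z_def cnj_sum sum_product
      by (subst sum.swap) (simp add: quadratic_form_def rank_one_def mult_ac)
    then show ?thesis by (simp flip: complex_norm_square)
  qed
  then show ?thesis
    by (simp add: psd_iff_quadratic_form cadj_def rank_one_def vec_eq_iff mult.commute)
qed

text \<open>\<open>rank_one\<close> of \<open>e_r + c e_s\<close> contributes \<open>cnj c\<close>
  at \<open>(r, s)\<close>, so here the coefficient is \<open>c\<close>. Every matrix unit becomes a
  combination of four positive semidefinite matrices, on which a positive map can be
  controlled.\<close>

lemma rank_one_polarization:
  "rank_one (two_point 1 r s) $ i $ j + \<i> * rank_one (two_point \<i> r s) $ i $ j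
    - rank_one (two_point (-1) r s) $ i $ j - \<i> * rank_one (two_point (-\<i>) r s) $ i $ j
    = (if i = r \<and> j = s then 4 else 0)"
  by (simp add: rank_one_def two_point_def algebra_simps)

lemma superop_polarization:
  "superop M (rank_one (two_point 1 r s)) $ p $ q + \<i> * superop M (rank_one (two_point \<i> r s)) $ p $ q
    - superop M (rank_one (two_point (-1) r s)) $ p $ q - \<i> * superop M (rank_one (two_point (-\<i>) r s)) $ p $ q
    = 4 * M $ (p, q) $ (r, s)"
proof -
  have "superop M (rank_one (two_point 1 r s)) $ p $ q + \<i> * superop M (rank_one (two_point \<i> r s)) $ p $ q
    - superop M (rank_one (two_point (-1) r s)) $ p $ q - \<i> * superop M (rank_one (two_point (-\<i>) r s)) $ p $ q
    = (\<Sum>b\<in>UNIV. M $ (p, q) $ b * (if fst b = r \<and> snd b = s then 4 else 0))"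
    unfolding superop_nth sum_distrib_left sum_subtractf[symmetric] sum.distrib[symmetric]
    by (simp add: algebra_simps flip: rank_one_polarization)
  also have "\<dots> = (\<Sum>b\<in>UNIV. if b = (r, s) then 4 * M $ (p, q) $ (r, s) else 0)"
    by (intro sum.cong) auto
  finally show ?thesis by simp
qed

lemma trace_rank_one_two_point_le:
  assumes "cmod c \<le> 1"
  shows "Re (trace (rank_one (two_point c r s :: 'n::finite \<Rightarrow> complex))) \<le> 4 * CARD('n)"
proof -
  have "Re (trace (rank_one (two_point c r s :: 'n \<Rightarrow> complex))) = (\<Sum>i\<in>UNIV. (cmod (two_point c r s i))\<^sup>2)"
    unfolding trace_def Re_sum
    by (intro sum.cong refl) (simp add: rank_one_def flip: complex_norm_square)
  also have "\<dots> \<le> (\<Sum>i\<in>(UNIV :: 'n set). 4)"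
  proof (rule sum_mono)
    fix i
    have "cmod (two_point c r s i) \<le> 2"
      unfolding two_point_def using assms by (intro order_trans[OF norm_triangle_ineq]) auto
    then have "(cmod (two_point c r s i))\<^sup>2 \<le> 2\<^sup>2" by (intro power_mono) auto
    then show "(cmod (two_point c r s i))\<^sup>2 \<le> 4" by simp
  qed
  finally show ?thesis by simp
qed

text \<open>The constant is 2, from comparing an entry with the trace, times
  \<open>4 * CARD('n)\<close>, which bounds the trace of the test matrices; the four polarization
  terms cancel against the factor 4.\<close>

lemma entry_le_of_psd_trace_nonincreasing:
  fixes M :: "complex ^ ('n::finite \<times> 'n) ^ ('n \<times> 'n)"
  assumes "\<And>X. psd X \<Longrightarrow> psd (superop M X) \<and> Re (trace (superop M X)) \<le> Re (trace X)"
  shows "cmod (M $ a $ b) \<le> 8 * CARD('n)"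
proof -
  obtain p q r s where ab: "a = (p, q)" "b = (r, s)" by (metis surj_pair)
  define Y where "Y c = superop M (rank_one (two_point c r s)) $ p $ q" for c
  have Y: "cmod (Y c) \<le> 8 * CARD('n)" if "cmod c \<le> 1" for c
    using psd_entry_le_trace[of "superop M (rank_one (two_point c r s))" p q]
      assms[OF psd_rank_one[of "two_point c r s"]] trace_rank_one_two_point_le[OF that, of r s]
    by (simp add: Y_def)
  have "4 * M $ a $ b = Y 1 + \<i> * Y \<i> - Y (-1) - \<i> * Y (-\<i>)"
    unfolding ab Y_def by (rule superop_polarization[symmetric])
  then have "4 * cmod (M $ a $ b) = cmod (Y 1 + \<i> * Y \<i> - Y (-1) - \<i> * Y (-\<i>))"
    by (metis norm_mult norm_numeral)
  also have "\<dots> \<le> cmod (Y 1) + cmod (\<i> * Y \<i>) + cmod (Y (-1)) + cmod (\<i> * Y (-\<i>))"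
    by (intro order_trans[OF norm_triangle_ineq4] add_right_mono order_trans[OF norm_triangle_ineq] order.refl)
  also have "\<dots> \<le> 4 * (8 * CARD('n))"
    using Y[of 1] Y[of \<i>] Y[of "-1"] Y[of "-\<i>"] by (simp add: norm_mult)
  finally show ?thesis by simp
qed

locale tridiagonal_quantum_chain = block_tridiagonal_chain \<Phi> A B C
  for \<Phi> :: "int \<Rightarrow> int \<Rightarrow> complex ^ ('n::finite \<times> 'n) ^ ('n \<times> 'n)" and A B C +
  assumes quantum: "quantum_Markov_chain \<Phi>"
begin

lemma psd_step:
  assumes "psd X"
  shows "psd (superop (A i) X)" "psd (superop (B i) X)" "psd (superop (C i) X)"
proof -
  have "psd (superop (\<Phi> j i) X)" for j i
    using quantum assms by (auto simp: quantum_Markov_chain_def intro: completely_positive_psd)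
  from this[of "i + 1" i] this[of i i] this[of "i - 1" i] show
    "psd (superop (A i) X)" "psd (superop (B i) X)" "psd (superop (C i) X)"
    using tridiagonal by (simp_all add: block_tridiagonal_def)
qed

lemma trace_step: "trace (superop (A i) X) + trace (superop (B i) X) + trace (superop (C i) X) = trace X"
proof -
  have zero: "\<Phi> k i = 0" if "k \<notin> {i + 1, i, i - 1}" for k
    using that tridiagonal unfolding block_tridiagonal_def by (metis abs_le_iff insertCI linorder_not_le add.commute
        diff_le_eq dual_order.antisym int_one_le_iff_zero_less minus_diff_eq zle_add1_eq_le zle_diff1_eq)
  have "(\<Sum>\<^sub>\<infinity>k. \<Phi> k i) = (\<Sum>k\<in>{i + 1, i, i - 1}. \<Phi> k i)"
    by (intro infsum_finite_support zero) auto
  also have "\<dots> = A i + B i + C i"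
    using tridiagonal by (simp add: block_tridiagonal_def add.assoc)
  finally have "trace (superop (A i + B i + C i) X) = trace X"
    using quantum unfolding quantum_Markov_chain_def trace_preserving_def by metis
  then show ?thesis by (simp add: superop_add trace_add)
qed

text \<open>A single block carries only part of the mass, so the trace may drop. The first step
  splits \<open>X\<close> into three positive semidefinite matrices whose traces add up to that of
  \<open>X\<close>; they sit at neighbouring sites, hence the induction over all \<open>i\<close>
  and \<open>X\<close>.\<close>

lemma P_psd_trace_nonincreasing:
  assumes "psd X"
  shows "psd (superop (P n j i) X) \<and> Re (trace (superop (P n j i) X)) \<le> Re (trace X)"
  using assms
proof (induction n arbitrary: i X)
  case 0
  \<comment> \<open>For \<open>j \<noteq> i\<close> the block is 0 and the claim is precisely this
    inequality.\<close>
  have "Re (trace X) \<ge> 0"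
    using order_trans[OF norm_ge_zero psd_entry_le_trace[OF 0, of undefined undefined]] by simp
  with 0 show ?case by (simp add: psd_0 trace_def)
next
  case (Suc n)
  note step = psd_step[OF Suc.prems, of i]
  note IH = step[THEN Suc.IH]
  have eq: "superop (P (Suc n) j i) X = superop (P n j (i + 1)) (superop (A i) X)
      + superop (P n j i) (superop (B i) X) + superop (P n j (i - 1)) (superop (C i) X)"
    by (simp add: P_Suc_right superop_add superop_mult del: block_power.simps)
  have "Re (trace (superop (A i) X)) + Re (trace (superop (B i) X)) + Re (trace (superop (C i) X)) = Re (trace X)"
    using arg_cong[OF trace_step[of i X], of Re] by simp
  moreover have "Re (trace (superop (P (Suc n) j i) X)) = Re (trace (superop (P n j (i + 1)) (superop (A i) X)))
      + Re (trace (superop (P n j i) (superop (B i) X))) + Re (trace (superop (P n j (i - 1)) (superop (C i) X)))"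
    unfolding eq by (simp add: trace_add)
  ultimately have "Re (trace (superop (P (Suc n) j i) X)) \<le> Re (trace X)"
    using IH(1)[of "i + 1"] IH(2)[of i] IH(3)[of "i - 1"] by linarith
  moreover have "psd (superop (P (Suc n) j i) X)"
    unfolding eq using IH by (intro psd_add) auto
  ultimately show ?case by blast
qed

lemma P_bounded: "cmod (P n j i $ a $ b) \<le> 8 * CARD('n)"
  by (rule entry_le_of_psd_trace_nonincreasing) (rule P_psd_trace_nonincreasing)

end

subsection \<open>The spectral measure of a symmetrizable chain\<close>

text \<open>The site at which the family with superscript \<open>\<alpha>\<close> is the identity
  and the other one is 0.\<close>

definition origin :: "2 \<Rightarrow> int"
  where "origin \<alpha> = (if \<alpha> = 1 then 0 else -1)"

theorem (in symmetrizable_chain) exists_spectral_density: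
  assumes bounded: "\<And>n j i a b. cmod (P n j i $ a $ b) \<le> K"
  shows "\<exists>\<rho> w. compactly_supported_measure \<rho> \<and> (\<forall>p q. integrable \<rho> (w p q)) \<and>
    (\<forall>p q k. (\<integral>x. of_real (x ^ k) * w p q x \<partial>\<rho>) = moment k (origin (fst p)) (origin (fst q)) $ snd p $ snd q) \<and>
    (\<forall>p q x. w q p x = cnj (w p q x)) \<and>
    (\<forall>v. AE x in \<rho>. Re (quadratic_form (\<lambda>p q. w p q x) v) \<ge> 0)"
proof -
  \<comment> \<open>The window contains every site within \<open>N\<close> steps of 0 or -1. The
    Gram vectors are columns of the powers multiplied by \<open>R\<close>, because the weight is
    \<open>cadj (R r) ** R r\<close>.\<close>
  interpret matrix_moments
    "\<lambda>k p q. moment k (origin (fst p)) (origin (fst q)) $ snd p $ snd q"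
    "\<lambda>p q. \<Sum>c\<in>UNIV. cmod (weight (origin (fst p)) $ snd p $ c) * K"
    "\<lambda>N. {- 1 - int N..int N} \<times> UNIV"
    "\<lambda>N k s q. (R (fst s) ** P k (fst s) (origin (fst q))) $ snd s $ snd q"
  proof
    fix k and p q :: "2 \<times> 'm"
    show "cmod (moment k (origin (fst p)) (origin (fst q)) $ snd p $ snd q)
      \<le> (\<Sum>c\<in>UNIV. cmod (weight (origin (fst p)) $ snd p $ c) * K)"
      unfolding moment_def matrix_matrix_mult_def vec_lambda_beta
      by (intro order_trans[OF norm_sum] sum_mono) (simp add: norm_mult mult_left_mono bounded)
    show "moment k (origin (fst q)) (origin (fst p)) $ snd q $ snd p
      = cnj (moment k (origin (fst p)) (origin (fst q)) $ snd p $ snd q)"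
      by (subst cadj_moment[symmetric]) (simp add: cadj_nth)
  next
    fix k N l :: nat and p q :: "2 \<times> 'm"
    assume "k \<le> N" "l \<le> N"
    then have "{origin (fst p) - int k..origin (fst p) + int k} \<subseteq> {- 1 - int N..int N}"
      by (auto simp: origin_def)
    then show "moment (k + l) (origin (fst p)) (origin (fst q)) $ snd p $ snd q
      = (\<Sum>s\<in>{- 1 - int N..int N} \<times> UNIV.
          cnj ((R (fst s) ** P k (fst s) (origin (fst p))) $ snd s $ snd p)
          * (R (fst s) ** P l (fst s) (origin (fst q))) $ snd s $ snd q)"
      by (simp only: moment_add[OF finite_atLeastAtMost_int] sum_component sum.cartesian_product')
         (simp add: sum.cartesian_product' matrix_matrix_mult_def[of "cadj _"] cadj_nth)
  qed
  show ?thesis by (rule exists_matrix_density)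
qed

subsection \<open>Gram matrices of matrix-valued functions\<close>

lemma matrix_mult_scaleR_left: "(c *\<^sub>R M) ** N = c *\<^sub>R (M ** N)" for M :: "complex ^ 'n ^ 'm"
  by (simp add: matrix_matrix_mult_def vec_eq_iff scaleR_sum_right)

lemma continuous_on_matrix_mult:
  "continuous_on S F \<Longrightarrow> continuous_on S (\<lambda>x. F x ** M)" for F :: "real \<Rightarrow> complex ^ 'n ^ 'm"
  unfolding matrix_matrix_mult_def
  by (intro continuous_on_vec_lambda continuous_intros) auto

locale matrix_density = compactly_supported_measure \<rho> for \<rho> +
  fixes w :: "'d::finite \<Rightarrow> 'd \<Rightarrow> real \<Rightarrow> complex"
  assumes density_integrable: "integrable \<rho> (w s t)"
    and density_hermitian: "w t s x = cnj (w s t x)"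
begin

text \<open>The sesquilinear pairing that integrates the adjoint of \<open>F\<close> against
  \<open>dW = w d\<rho>\<close> and \<open>G\<close>.\<close>

definition gram :: "(real \<Rightarrow> complex ^ 'p ^ 'd) \<Rightarrow> (real \<Rightarrow> complex ^ 'q ^ 'd) \<Rightarrow> complex ^ 'q ^ 'p"
  where "gram F G = (\<chi> p q. \<Sum>s\<in>UNIV. \<Sum>t\<in>UNIV. \<integral>x. cnj (F x $ s $ p) * G x $ t $ q * w s t x \<partial>\<rho>)"

lemma integrable_gram:
  assumes "continuous_on UNIV F" "continuous_on UNIV G"
  shows "integrable \<rho> (\<lambda>x. cnj (F x $ s $ p) * G x $ t $ q * w s t x)"
  using assms by (intro integrable_continuous_mult density_integrable continuous_intros) auto

lemma gram_add:
  assumes "continuous_on UNIV F" "continuous_on UNIV G" "continuous_on UNIV G'"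
  shows "gram F (\<lambda>x. G x + G' x) = gram F G + gram F G'"
  using integrable_gram[OF assms(1,2)] integrable_gram[OF assms(1,3)]
  by (simp add: gram_def vec_eq_iff ring_distribs sum.distrib)

lemma gram_mult:
  assumes "continuous_on UNIV F" "continuous_on UNIV G"
  shows "gram F (\<lambda>x. G x ** M) = gram F G ** M"
proof -
  have "gram F (\<lambda>x. G x ** M) $ p $ q = (gram F G ** M) $ p $ q" for p q
  proof -
    have eq: "cnj (F x $ s $ p) * (G x ** M) $ t $ q * w s t x
        = (\<Sum>c\<in>UNIV. (cnj (F x $ s $ p) * G x $ t $ c * w s t x) * M $ c $ q)" for x s t
      by (simp add: matrix_matrix_mult_def sum_distrib_left sum_distrib_right mult_ac)
    have "gram F (\<lambda>x. G x ** M) $ p $ q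
      = (\<Sum>s\<in>UNIV. \<Sum>t\<in>UNIV. \<Sum>c\<in>UNIV. (\<integral>x. cnj (F x $ s $ p) * G x $ t $ c * w s t x \<partial>\<rho>) * M $ c $ q)"
      unfolding gram_def vec_lambda_beta eq using integrable_gram[OF assms] by simp
    also have "\<dots> = (\<Sum>c\<in>UNIV. \<Sum>s\<in>UNIV. \<Sum>t\<in>UNIV. (\<integral>x. cnj (F x $ s $ p) * G x $ t $ c * w s t x \<partial>\<rho>) * M $ c $ q)"
      by (rule sum_rotate)
    also have "\<dots> = (gram F G ** M) $ p $ q"
      by (simp add: gram_def matrix_matrix_mult_def sum_distrib_right)
    finally show ?thesis .
  qed
  then show ?thesis by (simp add: vec_eq_iff)
qed

lemma cadj_gram:
  assumes "continuous_on UNIV F" "continuous_on UNIV G"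
  shows "cadj (gram F G) = gram G F"
proof -
  have "cnj (\<integral>x. cnj (F x $ s $ p) * G x $ t $ q * w s t x \<partial>\<rho>)
      = (\<integral>x. cnj (G x $ t $ q) * F x $ s $ p * w t s x \<partial>\<rho>)" for s t p q
    by (simp add: density_hermitian[of t s] mult_ac flip: Bochner_Integration.integral_cnj)
  then have "cadj (gram F G) $ q $ p = gram G F $ q $ p" for p q
    unfolding cadj_nth gram_def vec_lambda_beta cnj_sum by (subst sum.swap) simp
  then show ?thesis by (simp add: vec_eq_iff)
qed

text \<open>Multiplication by a real variable is symmetric for the pairing.\<close>

lemma gram_power: "gram (\<lambda>x. x ^ n *\<^sub>R F x) G = gram F (\<lambda>x. x ^ n *\<^sub>R G x)"
  by (simp add: gram_def vec_eq_iff mult_ac)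

end

subsection \<open>The Karlin--McGregor formula\<close>

text \<open>Cancelling \<open>A i\<close> determines column \<open>i + 1\<close> from columns
  \<open>i\<close> and \<open>i - 1\<close> for \<open>i \<ge> 0\<close>; cancelling
  \<open>C i\<close> determines column \<open>i - 1\<close> for \<open>i \<le> -1\<close>. The value
  at \<open>Suc n\<close> enters, so neighbouring columns are compared for all \<open>n\<close>
  together.\<close>

lemma three_term_recurrence_unique:
  fixes X Y :: "nat \<Rightarrow> int \<Rightarrow> complex ^ 'm::finite ^ 'm"
  assumes X: "\<And>n i. X (Suc n) i = X n (i + 1) ** A i + X n i ** B i + X n (i - 1) ** C i"
    and Y: "\<And>n i. Y (Suc n) i = Y n (i + 1) ** A i + Y n i ** B i + Y n (i - 1) ** C i"
    and A: "\<And>i. i \<ge> 0 \<Longrightarrow> invertible (A i)" and C: "\<And>i. i \<le> -1 \<Longrightarrow> invertible (C i)"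
    and init: "\<And>n. X n 0 = Y n 0" "\<And>n. X n (-1) = Y n (-1)"
  shows "X n i = Y n i"
proof -
  have cancel: "M = N" if "invertible L" "M ** L = N ** L" for L M N :: "complex ^ 'm ^ 'm"
    using that unfolding invertible_def by (metis matrix_mul_assoc matrix_mul_rid)
  have up: "(\<forall>n. X n i = Y n i) \<and> (\<forall>n. X n (i - 1) = Y n (i - 1))" if "i \<ge> 0" for i
    using that
  proof (induction i rule: int_ge_induct)
    case base
    then show ?case using init by simp
  next
    case (step i)
    have "X n (i + 1) = Y n (i + 1)" for n
    proof (rule cancel[OF A])
      have e: "X n i = Y n i" "X n (i - 1) = Y n (i - 1)" for n
        using step.IH by simp_all
      show "X n (i + 1) ** A i = Y n (i + 1) ** A i"
        using trans[OF sym[OF X[of n i, unfolded e]] Y[of n i]] by simp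
    qed (use step.hyps in simp)
    with step show ?case by simp
  qed
  have down: "(\<forall>n. X n i = Y n i) \<and> (\<forall>n. X n (i + 1) = Y n (i + 1))" if "i \<le> -1" for i
    using that
  proof (induction i rule: int_le_induct)
    case base
    then show ?case using init by simp
  next
    case (step i)
    have "X n (i - 1) = Y n (i - 1)" for n
    proof (rule cancel[OF C])
      have e: "X n i = Y n i" "X n (i + 1) = Y n (i + 1)" for n
        using step.IH by simp_all
      show "X n (i - 1) ** C i = Y n (i - 1) ** C i"
        using trans[OF sym[OF X[of n i, unfolded e]] Y[of n i]] by simp
    qed (use step.hyps in simp)
    with step show ?case by simp
  qed
  show ?thesis
    using up[of i] down[of i] by (cases "i \<ge> 0") auto
qed

lemma sum_UNIV_prod: "(\<Sum>s\<in>UNIV. f s) = (\<Sum>\<alpha>\<in>UNIV. \<Sum>a\<in>UNIV. f (\<alpha>, a))"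
  for f :: "'a::finite \<times> 'b::finite \<Rightarrow> 'c::comm_monoid_add"
  by (simp add: sum.cartesian_product flip: UNIV_Times_UNIV)

text \<open>Both families in one tall matrix, so that the double sum over \<open>\<alpha>\<close>
  and \<open>\<beta>\<close> becomes a single \<open>gram\<close> pairing.\<close>

definition stacked :: "(2 \<Rightarrow> int \<Rightarrow> complex poly ^ 'm ^ 'm) \<Rightarrow> int \<Rightarrow> real \<Rightarrow> complex ^ 'm ^ (2 \<times> 'm::finite)"
  where "stacked Q i x = (\<chi> s q. eval_pmat (Q (fst s) i) x $ snd s $ q)"

lemma continuous_on_eval_pmat: "continuous_on UNIV (eval_pmat P)"
  unfolding eval_pmat_def by (intro continuous_on_vec_lambda continuous_intros)

lemma continuous_on_stacked: "continuous_on UNIV (stacked Q i)"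
  unfolding stacked_def
  by (intro continuous_on_vec_lambda continuous_intros continuous_on_eval_pmat)

lemma eval_pmat_0: "eval_pmat 0 x = 0"
  by (simp add: eval_pmat_def vec_eq_iff)

lemma eval_pmat_1: "eval_pmat (mat 1) x = mat 1"
  by (simp add: eval_pmat_def mat_def vec_eq_iff)

lemma stacked_origin:
  assumes "KM_polynomials A B C Q"
  shows "stacked Q (origin \<alpha>) x $ s $ p = (if s = (\<alpha>, p) then 1 else 0)"
proof -
  have "Q \<beta> (origin \<alpha>) = (if \<beta> = \<alpha> then mat 1 else 0)" for \<beta>
    using assms exhaust_2[of \<alpha>] exhaust_2[of \<beta>] by (auto simp: KM_polynomials_def origin_def)
  then show ?thesis
    by (cases s) (simp add: stacked_def eval_pmat_1 eval_pmat_0, simp add: mat_def)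
qed

lemma stacked_recurrence:
  assumes "KM_polynomials A B C Q"
  shows "x *\<^sub>R stacked Q i x = stacked Q (i + 1) x ** A i + stacked Q i x ** B i + stacked Q (i - 1) x ** C i"
proof -
  have "(x *\<^sub>R eval_pmat (Q \<alpha> i) x) $ a $ b
    = (eval_pmat (Q \<alpha> (i + 1)) x ** A i + eval_pmat (Q \<alpha> i) x ** B i + eval_pmat (Q \<alpha> (i - 1)) x ** C i) $ a $ b" for \<alpha> a b
    using assms unfolding KM_polynomials_def by simp
  then show ?thesis
    by (simp add: stacked_def vec_eq_iff matrix_matrix_mult_def)
qed

locale block_matrix_density = matrix_density \<rho> w
  for \<rho> and w :: "2 \<times> 'm::finite \<Rightarrow> 2 \<times> 'm \<Rightarrow> real \<Rightarrow> complex"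
begin

text \<open>One factor \<open>x\<close> is absorbed by the recurrence of the polynomials, which
  gives the integrals the same recurrence in \<open>i\<close> as the moments.\<close>

lemma gram_stacked_Suc:
  assumes "KM_polynomials A B C Q" and F: "continuous_on UNIV F"
  shows "gram F (\<lambda>x. x ^ Suc n *\<^sub>R stacked Q i x)
    = gram F (\<lambda>x. x ^ n *\<^sub>R stacked Q (i + 1) x) ** A i + gram F (\<lambda>x. x ^ n *\<^sub>R stacked Q i x) ** B i
      + gram F (\<lambda>x. x ^ n *\<^sub>R stacked Q (i - 1) x) ** C i"
proof -
  define V where "V i x = x ^ n *\<^sub>R stacked Q i x" for i x
  have V: "continuous_on UNIV (V i)" for i
    unfolding V_def by (intro continuous_intros continuous_on_stacked)
  note VM = continuous_on_matrix_mult[OF V]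
  have "x ^ Suc n *\<^sub>R stacked Q i x = x ^ n *\<^sub>R (x *\<^sub>R stacked Q i x)" for x
    by (simp add: mult.commute)
  then have "x ^ Suc n *\<^sub>R stacked Q i x = V (i + 1) x ** A i + V i x ** B i + V (i - 1) x ** C i" for x
    by (simp only: stacked_recurrence[OF assms(1)] V_def scaleR_right_distrib matrix_mult_scaleR_left)
  then have "gram F (\<lambda>x. x ^ Suc n *\<^sub>R stacked Q i x)
      = gram F (\<lambda>x. V (i + 1) x ** A i + V i x ** B i + V (i - 1) x ** C i)"
    by presburger
  also have "\<dots> = gram F (V (i + 1)) ** A i + gram F (V i) ** B i + gram F (V (i - 1)) ** C i"
    by (simp add: gram_add gram_mult F V VM continuous_on_add)
  finally show ?thesis unfolding V_def .
qed

lemma sum_matrix_integral_eq_gram: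
  "(\<Sum>\<alpha>\<in>UNIV. \<Sum>\<beta>\<in>UNIV. matrix_integral (\<lambda>x. x ^ n *\<^sub>R cadj (eval_pmat (Q \<alpha> j) x))
      (block (\<lambda>S. \<chi> p q. LINT x:S|\<rho>. w p q x) \<alpha> \<beta>) (eval_pmat (Q \<beta> i)))
    = gram (stacked Q j) (\<lambda>x. x ^ n *\<^sub>R stacked Q i x)" (is "?L = ?G")
proof -
  have "?L $ p $ q = ?G $ p $ q" for p q
  proof -
    define J where "J \<alpha> \<beta> a b = (\<integral>x. cnj (stacked Q j x $ (\<alpha>, a) $ p) * (x ^ n *\<^sub>R stacked Q i x) $ (\<beta>, b) $ q
        * w (\<alpha>, a) (\<beta>, b) x \<partial>\<rho>)" for \<alpha> \<beta> a b
    have "cm_integral (\<lambda>S. LINT x:S|\<rho>. w (\<alpha>, a) (\<beta>, b) x)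
        (\<lambda>x. (x ^ n *\<^sub>R cadj (eval_pmat (Q \<alpha> j) x)) $ p $ a * eval_pmat (Q \<beta> i) x $ b $ q) = J \<alpha> \<beta> a b" for \<alpha> \<beta> a b
    proof -
      have eq: "(x ^ n *\<^sub>R cadj (eval_pmat (Q \<alpha> j) x)) $ p $ a * eval_pmat (Q \<beta> i) x $ b $ q
        = cnj (stacked Q j x $ (\<alpha>, a) $ p) * (x ^ n *\<^sub>R stacked Q i x) $ (\<beta>, b) $ q" for x
        by (simp add: stacked_def cadj_nth)
      show ?thesis
        unfolding eq J_def
        by (intro cm_integral_density density_integrable continuous_intros continuous_on_stacked)
    qed
    then have "?L $ p $ q = (\<Sum>\<alpha>\<in>UNIV. \<Sum>\<beta>\<in>UNIV. \<Sum>a\<in>UNIV. \<Sum>b\<in>UNIV. J \<alpha> \<beta> a b)"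
      by (simp add: matrix_integral_def block_def)
    also have "\<dots> = (\<Sum>\<alpha>\<in>UNIV. \<Sum>a\<in>UNIV. \<Sum>\<beta>\<in>UNIV. \<Sum>b\<in>UNIV. J \<alpha> \<beta> a b)"
      by (intro sum.cong refl sum.swap)
    also have "\<dots> = ?G $ p $ q"
      unfolding gram_def vec_lambda_beta sum_UNIV_prod J_def ..
    finally show ?thesis .
  qed
  then show ?thesis by (simp add: vec_eq_iff)
qed

lemma gram_stacked_origin:
  assumes "KM_polynomials A B C Q"
  shows "gram (stacked Q (origin \<alpha>)) (\<lambda>x. x ^ n *\<^sub>R stacked Q (origin \<beta>) x) $ p $ q
    = (\<integral>x. of_real (x ^ n) * w (\<alpha>, p) (\<beta>, q) x \<partial>\<rho>)"
proof -
  have "(\<integral>x. cnj (stacked Q (origin \<alpha>) x $ s $ p) * (x ^ n *\<^sub>R stacked Q (origin \<beta>) x) $ t $ q * w s t x \<partial>\<rho>)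
    = (if t = (\<beta>, q) then if s = (\<alpha>, p) then \<integral>x. of_real (x ^ n) * w (\<alpha>, p) (\<beta>, q) x \<partial>\<rho> else 0 else 0)" for s t
    by (simp add: stacked_origin[OF assms]) (simp add: scaleR_conv_of_real)
  then show ?thesis by (simp only: gram_def vec_lambda_beta) simp
qed

end

theorem (in symmetrizable_chain) Karlin_McGregor:
  assumes bounded: "\<And>n j i a b. cmod (P n j i $ a $ b) \<le> K"
    and R: "\<And>n. invertible (R n)"
    and A: "\<And>n. n \<ge> 0 \<Longrightarrow> invertible (A n)"
    and C: "\<And>n. n \<le> -1 \<Longrightarrow> invertible (C n)"
    and Q: "KM_polynomials A B C Q"
  shows "\<exists>W :: real set \<Rightarrow> complex ^ (2 \<times> 'm) ^ (2 \<times> 'm). weight_matrix W \<and>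
    (\<forall>S\<in>sets borel. block W 2 1 S = cadj (block W 1 2 S)) \<and>
    (\<forall>i j n. P n j i = (\<Sum>\<alpha>\<in>UNIV. \<Sum>\<beta>\<in>UNIV. matrix_inv (cadj (R j) ** R j) **
      matrix_integral (\<lambda>x. x ^ n *\<^sub>R cadj (eval_pmat (Q \<alpha> j) x)) (block W \<alpha> \<beta>) (eval_pmat (Q \<beta> i))))"
proof -
  from exists_spectral_density[OF bounded] obtain \<rho> w where \<rho>: "compactly_supported_measure \<rho>"
    and spectral: "\<forall>p q. integrable \<rho> (w p q)"
      "\<forall>p q k. (\<integral>x. of_real (x ^ k) * w p q x \<partial>\<rho>) = moment k (origin (fst p)) (origin (fst q)) $ snd p $ snd q"
      "\<forall>p q x. w q p x = cnj (w p q x)"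
      "\<forall>v. AE x in \<rho>. Re (quadratic_form (\<lambda>p q. w p q x) v) \<ge> 0"
    by (elim exE conjE)
  note int = spectral(1)[rule_format] and moments = spectral(2)[rule_format]
    and herm = spectral(3)[rule_format] and pos = spectral(4)[rule_format]
  interpret block_matrix_density \<rho> w
    unfolding block_matrix_density_def matrix_density_def matrix_density_axioms_def
    using \<rho> spectral(1,3) by blast
  define W where "W = (\<lambda>S. \<chi> p q. LINT x:S|\<rho>. w p q x)"
  have W: "weight_matrix W"
    unfolding W_def by (rule weight_matrix_density[OF int herm pos])
  have "block W 2 1 S = cadj (block W 1 2 S)" if "S \<in> sets borel" for S
  proof -
    have "cadj (W S) = W S"
      using W that by (simp add: weight_matrix_def psd_def hermitian_def)
    then have entry: "W S $ p $ q = cnj (W S $ q $ p)" for p q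
      by (metis cadj_nth)
    show ?thesis
      unfolding block_def cadj_def vec_eq_iff vec_lambda_beta by (intro allI entry)
  qed
  moreover have "P n j i = (\<Sum>\<alpha>\<in>UNIV. \<Sum>\<beta>\<in>UNIV. matrix_inv (cadj (R j) ** R j) **
      matrix_integral (\<lambda>x. x ^ n *\<^sub>R cadj (eval_pmat (Q \<alpha> j) x)) (block W \<alpha> \<beta>) (eval_pmat (Q \<beta> i)))" for i j n
  proof -
    define X where "X j n i = gram (stacked Q j) (\<lambda>x. x ^ n *\<^sub>R stacked Q i x)" for j n i
    have X_Suc: "X j (Suc n) i = X j n (i + 1) ** A i + X j n i ** B i + X j n (i - 1) ** C i" for j n i
      unfolding X_def by (rule gram_stacked_Suc[OF Q continuous_on_stacked])
    have X_cadj: "cadj (X j n i) = X i n j" for j n i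
      unfolding X_def
      by (subst cadj_gram) (simp_all add: gram_power continuous_on_stacked continuous_on_scaleR continuous_intros)
    have X_origin: "X (origin \<alpha>) n (origin \<beta>) = moment n (origin \<alpha>) (origin \<beta>)" for \<alpha> \<beta> n
      unfolding vec_eq_iff X_def gram_stacked_origin[OF Q] moments by simp
    have origin_12: "origin 1 = 0" "origin 2 = -1"
      by (simp_all add: origin_def)
    \<comment> \<open>The moment problem settles only the four blocks with both indices in
      \<open>{0, -1}\<close>; uniqueness in \<open>i\<close> extends them to two full rows.\<close>
    have X_row: "X (origin \<alpha>) n i = moment n (origin \<alpha>) i" for \<alpha> n i
    proof (rule three_term_recurrence_unique[where X = "X (origin \<alpha>)" and Y = "\<lambda>n. moment n (origin \<alpha>)"
          and A = A and B = B and C = C])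
      show "X (origin \<alpha>) n 0 = moment n (origin \<alpha>) 0" "X (origin \<alpha>) n (-1) = moment n (origin \<alpha>) (-1)" for n
        using X_origin[of \<alpha> n 1] X_origin[of \<alpha> n 2] unfolding origin_12 .
    qed (erule A C | rule X_Suc moment_Suc_right)+
    \<comment> \<open>Adjoints turn these rows into columns, the initial data for a second use of
      uniqueness with arbitrary \<open>j\<close>.\<close>
    have X_column: "X j n (origin \<alpha>) = moment n j (origin \<alpha>)" for j n \<alpha>
      using arg_cong[OF X_row[of \<alpha> n j], of cadj] by (simp only: X_cadj cadj_moment)
    have "X j n i = moment n j i"
    proof (rule three_term_recurrence_unique[where X = "X j" and Y = "\<lambda>n. moment n j"
          and A = A and B = B and C = C])
      show "X j n 0 = moment n j 0" "X j n (-1) = moment n j (-1)" for n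
        using X_column[of j n 1] X_column[of j n 2] unfolding origin_12 .
    qed (erule A C | rule X_Suc moment_Suc_right)+
    then have "P n j i = matrix_inv (cadj (R j) ** R j) ** X j n i"
      by (simp add: moment_def weight_def matrix_inv_mult_cancel invertible_mult invertible_cadj R)
    then show ?thesis
      by (simp add: X_def W_def sum_matrix_integral_eq_gram[symmetric] matrix_mult_sum_right)
  qed
  ultimately show ?thesis
    using W by blast
qed

theorem mainTheorem5:
  fixes \<Phi> :: "int \<Rightarrow> int \<Rightarrow> complex ^ ('n::finite \<times> 'n) ^ ('n \<times> 'n)"
    and A B C E R :: "int \<Rightarrow> complex ^ ('n \<times> 'n) ^ ('n \<times> 'n)"
    and Q :: "2 \<Rightarrow> int \<Rightarrow> complex poly ^ ('n \<times> 'n) ^ ('n \<times> 'n)"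
  assumes "quantum_Markov_chain \<Phi>"
    and "block_tridiagonal \<Phi> A B C"
    and "\<And>n. n \<ge> 0 \<Longrightarrow> invertible (A n)"
    and "\<And>n. n \<le> -1 \<Longrightarrow> invertible (C n)"
    and "\<And>n. hermitian (E n)"
    and "\<And>n. invertible (R n)"
    and "\<And>n. n \<ge> 0 \<Longrightarrow>
      cadj (A n) ** cadj (R (n + 1)) ** R (n + 1) = cadj (R n) ** R n ** C (n + 1)"
    and "\<And>n. n \<ge> 0 \<Longrightarrow>
      cadj (R (- n - 1)) ** R (- n - 1) ** C (- n) = cadj (A (- n - 1)) ** cadj (R (- n)) ** R (- n)"
    and "\<And>n. R n ** B n = E n ** R n"
    and "KM_polynomials A B C Q"
  shows "\<exists>W :: real set \<Rightarrow> complex ^ (2 \<times> ('n \<times> 'n)) ^ (2 \<times> ('n \<times> 'n)).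
    weight_matrix W \<and>
    (\<forall>S \<in> sets borel. block W 2 1 S = cadj (block W 1 2 S)) \<and>
    (\<forall>i j n. block_power \<Phi> n j i =
      (\<Sum>\<alpha>\<in>UNIV. \<Sum>\<beta>\<in>UNIV. matrix_inv (cadj (R j) ** R j) **
        matrix_integral (\<lambda>x. x ^ n *\<^sub>R cadj (eval_pmat (Q \<alpha> j) x)) (block W \<alpha> \<beta>)
          (eval_pmat (Q \<beta> i))))"
proof -
  have sym_AC: "cadj (A k) ** (cadj (R (k + 1)) ** R (k + 1)) = (cadj (R k) ** R k) ** C (k + 1)" for k
  proof (cases "k \<ge> 0")
    case True
    then show ?thesis using assms(7)[of k] by (simp add: matrix_mul_assoc)
  next
    case False
    \<comment> \<open>With \<open>n = - k - 1\<close> one has \<open>- n - 1 = k\<close> and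
      \<open>- n = k + 1\<close>, so the two families of hypotheses cover all integers.\<close>
    then show ?thesis using assms(8)[of "- k - 1"] by (simp add: matrix_mul_assoc add.commute)
  qed
  have sym_B: "cadj (B k) ** (cadj (R k) ** R k) = (cadj (R k) ** R k) ** B k" for k
  proof -
    \<comment> \<open>Both sides of the goal equal \<open>cadj (R k) ** E k ** R k\<close>, which is
      where the Hermitian matrices \<open>E k\<close> enter.\<close>
    have "cadj (B k) ** cadj (R k) = cadj (R k) ** E k"
      using arg_cong[OF assms(9)[of k], of cadj] assms(5)[of k] by (simp add: cadj_mult hermitian_def)
    then show ?thesis
      using assms(9)[of k] by (simp add: matrix_mul_assoc) (simp flip: matrix_mul_assoc)
  qed
  interpret symmetrizable_chain \<Phi> A B C R
    by unfold_locales (rule assms(2) sym_AC sym_B)+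
  interpret tridiagonal_quantum_chain \<Phi> A B C
    by unfold_locales (rule assms(1))
  show ?thesis
    by (rule Karlin_McGregor[OF P_bounded assms(6) assms(3) assms(4) assms(10)])
qed

end
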